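(* Let $n\ge2$ and $2\le k\le2n-2$. The set consisting of the polynomials $E_iE_i\Delta_n$ for integers $1\le i\le n-2$ with $2i=k$, $E_iE_{i+1}\Delta_n$ for integers $1\le i\le n-3$ with $2i+1=k$, and $(E_jE_i-E_{j-1}E_{i+1})\Delta_n$ for integers $1\le i\le n-4$, $i+2\le j\le n-2$ with $i+j=k$, is a basis of $A_n^{k,2}$. For all other integers $k$, $\dim A_n^{k,2}=0$.
   Context: $A_n$ is the space of $P\in\mathbb{Q}[x_1,\dots,x_n,y_1,\dots,y_n]$ with $\sum_{i=1}^n\partial_{x_i}^a\partial_{y_i}^bP=0$ for all $a,b\ge0$ with $a+b>0$, which are alternating under the diagonal action of $S_n$. $A_n^{k,l}$ is the subspace of elements bihomogeneous of degree $\frac{n(n-1)}2-k$ in the $x$'s and $l$ in the $y$'s. $\Delta_n=\det\big(x_i^{n-j}/(n-j)!\big)_{i,j=1}^n$ and $E_a=\sum_{i=1}^ny_i\partial_{x_i}^a$ for $a>0$. (In the paper's notation these polynomials are $F_T\Delta_n$ for the tableaux $T$ given by a row $(i,i)$, a row $(i,i+1)$, or a column with $i$ below $j$.) *)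

theory Defs
  imports
    "HOL-Library.Poly_Mapping"
    "HOL-Combinatorics.Permutations"
    "Jordan_Normal_Form.Determinant"
begin

text \<open>
  Polynomials over the rationals are finitely supported maps from monomials to coefficients, and
  monomials are finitely supported maps from variables to exponents. The type has infinitely many
  variables; the polynomial ring in \<open>x\<^sub>1, \<dots>, x\<^sub>n, y\<^sub>1, \<dots>, y\<^sub>n\<close> is the carrier set \<open>polys n\<close>.
\<close>

datatype xyvar = XV nat | YV nat

type_synonym mon = "xyvar \<Rightarrow>\<^sub>0 nat"
type_synonym qpoly = "mon \<Rightarrow>\<^sub>0 rat"

abbreviation mcoeff :: "qpoly \<Rightarrow> mon \<Rightarrow> rat" where
  "mcoeff \<equiv> Poly_Mapping.lookup"

abbreviation expo :: "mon \<Rightarrow> xyvar \<Rightarrow> nat" where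
  "expo \<equiv> Poly_Mapping.lookup"

definition var :: "xyvar \<Rightarrow> qpoly" where
  "var v = Poly_Mapping.single (Poly_Mapping.single v 1) 1"

definition scal :: "rat \<Rightarrow> qpoly \<Rightarrow> qpoly" where
  "scal c P = Poly_Mapping.single 0 c * P"

global_interpretation qvs: vector_space scal
proof
  fix a b :: rat and P Q :: qpoly
  show "scal a (P + Q) = scal a P + scal a Q"
    by (simp only: scal_def distrib_left)
  show "scal (a + b) P = scal a P + scal b P"
    by (simp only: scal_def single_add distrib_right)
  show "scal a (scal b P) = scal (a * b) P"
    by (simp only: scal_def mult.assoc[symmetric] mult_single add_0)
  show "scal 1 P = P"
    by (simp only: scal_def single_one mult_1)
qed

definition polys :: "nat \<Rightarrow> qpoly set" where
  "polys n = {P. \<forall>m\<in>Poly_Mapping.keys P. Poly_Mapping.keys m \<subseteq> XV ` {1..n} \<union> YV ` {1..n}}"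

text \<open>The partial derivative; if \<open>v\<close> does not occur in \<open>m\<close> the coefficient below is zero.\<close>

definition pderiv_var :: "xyvar \<Rightarrow> qpoly \<Rightarrow> qpoly" where
  "pderiv_var v P =
     (\<Sum>m\<in>Poly_Mapping.keys P.
        Poly_Mapping.single (m - Poly_Mapping.single v 1) (of_nat (expo m v) * mcoeff P m))"

primrec perm_var :: "(nat \<Rightarrow> nat) \<Rightarrow> xyvar \<Rightarrow> xyvar" where
  "perm_var \<sigma> (XV i) = XV (\<sigma> i)"
| "perm_var \<sigma> (YV i) = YV (\<sigma> i)"

text \<open>Diagonal action: substitute \<open>x\<^sub>i\<close> by \<open>x\<^bsub>\<sigma>(i)\<^esub>\<close> and \<open>y\<^sub>i\<close> by \<open>y\<^bsub>\<sigma>(i)\<^esub>\<close>.\<close>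

definition perm_act :: "(nat \<Rightarrow> nat) \<Rightarrow> qpoly \<Rightarrow> qpoly" where
  "perm_act \<sigma> P =
     (\<Sum>m\<in>Poly_Mapping.keys P.
        scal (mcoeff P m) (\<Prod>v\<in>Poly_Mapping.keys m. var (perm_var \<sigma> v) ^ expo m v))"

definition diag_harmonic :: "nat \<Rightarrow> qpoly \<Rightarrow> bool" where
  "diag_harmonic n P \<longleftrightarrow>
     (\<forall>a b. a + b > 0 \<longrightarrow>
        (\<Sum>i=1..n. (pderiv_var (XV i) ^^ a) ((pderiv_var (YV i) ^^ b) P)) = 0)"

definition alternating :: "nat \<Rightarrow> qpoly \<Rightarrow> bool" where
  "alternating n P \<longleftrightarrow>
     (\<forall>\<sigma>. \<sigma> permutes {1..n} \<longrightarrow> perm_act \<sigma> P = scal (of_int (sign \<sigma>)) P)"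

definition alt_harm :: "nat \<Rightarrow> qpoly set" where
  "alt_harm n = {P \<in> polys n. diag_harmonic n P \<and> alternating n P}"

text \<open>
  Degrees are integers: a prescribed negative degree leaves only the zero polynomial, which is
  bihomogeneous of every bidegree.
\<close>

definition bihomogeneous :: "nat \<Rightarrow> int \<Rightarrow> int \<Rightarrow> qpoly \<Rightarrow> bool" where
  "bihomogeneous n d e P \<longleftrightarrow>
     (\<forall>m\<in>Poly_Mapping.keys P.
        int (\<Sum>i=1..n. expo m (XV i)) = d \<and> int (\<Sum>i=1..n. expo m (YV i)) = e)"

definition alt_harm_bi :: "nat \<Rightarrow> int \<Rightarrow> int \<Rightarrow> qpoly set" where
  "alt_harm_bi n k l = {P \<in> alt_harm n. bihomogeneous n (int n * (int n - 1) div 2 - k) l P}"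

text \<open>Library matrices are indexed from 0, hence the shift of both indices.\<close>

definition Delta_poly :: "nat \<Rightarrow> qpoly" where
  "Delta_poly n = det (mat n n (\<lambda>(i', j'). let i = i' + 1; j = j' + 1 in
     scal (1 / fact (n - j)) (var (XV i) ^ (n - j))))"

definition E_op :: "nat \<Rightarrow> nat \<Rightarrow> qpoly \<Rightarrow> qpoly" where
  "E_op n a P = (\<Sum>i=1..n. var (YV i) * (pderiv_var (XV i) ^^ a) P)"

definition is_basis_of :: "qpoly set \<Rightarrow> qpoly set \<Rightarrow> bool" where
  "is_basis_of B V \<longleftrightarrow> qvs.independent B \<and> qvs.span B = V"

definition tableau_polys :: "nat \<Rightarrow> int \<Rightarrow> qpoly set" where
  "tableau_polys n k =
     {E_op n i (E_op n i (Delta_poly n)) | i :: nat.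
        1 \<le> i \<and> int i \<le> int n - 2 \<and> 2 * int i = k}
   \<union> {E_op n i (E_op n (i + 1) (Delta_poly n)) | i :: nat.
        1 \<le> i \<and> int i \<le> int n - 3 \<and> 2 * int i + 1 = k}
   \<union> {E_op n j (E_op n i (Delta_poly n)) - E_op n (j - 1) (E_op n (i + 1) (Delta_poly n)) | i j :: nat.
        1 \<le> i \<and> int i \<le> int n - 4 \<and> i + 2 \<le> j \<and> int j \<le> int n - 2 \<and> int i + int j = k}"

text \<open>
  The library's \<open>dim\<close> is 0 on infinite-dimensional spaces too; lemma \<open>alt_harm_bi_finite_dimensional\<close> rules that out,
  so \<open>qvs.dim (alt_harm_bi n k l) = 0\<close> has its usual meaning.
\<close>

lemma finite_monomials:
  "finite {m :: mon. Poly_Mapping.keys m \<subseteq> XV ` {1..n} \<union> YV ` {1..n} \<and>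
     int (\<Sum>i=1..n. expo m (XV i)) = d \<and> int (\<Sum>i=1..n. expo m (YV i)) = e}"
  (is "finite ?M")
proof -
  let ?V = "XV ` {1..n} \<union> YV ` {1..n}"
  let ?F = "{f. \<forall>v. (v \<in> ?V \<longrightarrow> f v \<in> {..nat d + nat e}) \<and> (v \<notin> ?V \<longrightarrow> f v = 0)}"
  have "Poly_Mapping.lookup ` ?M \<subseteq> ?F"
  proof clarify
    fix m :: mon and v
    assume k: "Poly_Mapping.keys m \<subseteq> ?V"
    have le: "expo m (c j) \<le> (\<Sum>i=1..n. expo m (c i))" if "j \<in> {1..n}" for c :: "nat \<Rightarrow> xyvar" and j
      using that by (intro member_le_sum) auto
    have "expo m v \<in> {..nat (int (\<Sum>i=1..n. expo m (XV i))) + nat (int (\<Sum>i=1..n. expo m (YV i)))}"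
      if v: "v \<in> ?V"
      unfolding nat_int atMost_iff using v
    proof
      assume "v \<in> XV ` {1..n}"
      then obtain j where j: "v = XV j" "j \<in> {1..n}" by blast
      show "expo m v \<le> (\<Sum>i=1..n. expo m (XV i)) + (\<Sum>i=1..n. expo m (YV i))"
        unfolding j(1) using le[OF j(2), of XV] by linarith
    next
      assume "v \<in> YV ` {1..n}"
      then obtain j where j: "v = YV j" "j \<in> {1..n}" by blast
      show "expo m v \<le> (\<Sum>i=1..n. expo m (XV i)) + (\<Sum>i=1..n. expo m (YV i))"
        unfolding j(1) using le[OF j(2), of YV] by linarith
    qed
    moreover have "expo m v = 0" if "v \<notin> ?V"
      using k that by (meson in_keys_iff subsetD)
    ultimately show "(v \<in> ?V \<longrightarrow> expo m v \<in>
        {..nat (int (\<Sum>i=1..n. expo m (XV i))) + nat (int (\<Sum>i=1..n. expo m (YV i)))}) \<and>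
        (v \<notin> ?V \<longrightarrow> expo m v = 0)" by blast
  qed
  moreover have "finite ?F"
    by (rule finite_set_of_finite_funs) auto
  ultimately have "finite (Poly_Mapping.lookup ` ?M)"
    by (rule finite_subset)
  thus ?thesis
    by (rule finite_imageD) (rule inj_onI, simp only: lookup_inject)
qed

lemma alt_harm_bi_finite_dimensional: "\<exists>B. finite B \<and> alt_harm_bi n k l \<subseteq> qvs.span B"
proof -
  let ?M = "{m :: mon. Poly_Mapping.keys m \<subseteq> XV ` {1..n} \<union> YV ` {1..n} \<and>
     int (\<Sum>i=1..n. expo m (XV i)) = int n * (int n - 1) div 2 - k \<and>
     int (\<Sum>i=1..n. expo m (YV i)) = l}"
  let ?B = "(\<lambda>m. Poly_Mapping.single m 1) ` ?M :: qpoly set"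
  have "P \<in> qvs.span ?B" if P: "P \<in> alt_harm_bi n k l" for P
  proof -
    have "P = (\<Sum>m\<in>Poly_Mapping.keys P. Poly_Mapping.single m (mcoeff P m))"
    proof (rule poly_mapping_eqI)
      fix m'
      have "(\<Sum>m\<in>Poly_Mapping.keys P. if m = m' then mcoeff P m else 0) = mcoeff P m'"
        by (subst sum.delta) (simp_all add: not_in_keys_iff_lookup_eq_zero)
      thus "mcoeff P m' = mcoeff (\<Sum>m\<in>Poly_Mapping.keys P. Poly_Mapping.single m (mcoeff P m)) m'"
        by (simp only: lookup_sum lookup_single when_def)
    qed
    also have "\<dots> = (\<Sum>m\<in>Poly_Mapping.keys P. scal (mcoeff P m) (Poly_Mapping.single m 1))"
      by (simp only: scal_def mult_single add_0 mult_1_right)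
    also have "\<dots> \<in> qvs.span ?B"
      using P by (intro qvs.span_sum qvs.span_scale qvs.span_base imageI)
        (auto simp: alt_harm_bi_def alt_harm_def polys_def bihomogeneous_def)
    finally show ?thesis .
  qed
  thus ?thesis
    using finite_monomials by (intro exI[of _ ?B]) auto
qed

end

theory Submission
  imports Defs
begin

text \<open>
  Write \<open>P = \<Sum> y\<^sub>i y\<^sub>j Q\<^sub>i\<^sub>j\<close>. All \<open>Q\<^sub>i\<^sub>j\<close> are \<open>S\<^sub>n\<close>-harmonic in \<open>x\<close>, and \<open>Q\<^sub>1\<^sub>2\<close> determines \<open>P\<close>. As
  \<open>Q\<^sub>1\<^sub>2\<close> alternates in \<open>x\<^sub>3, \<dots>, x\<^sub>n\<close>, peeling off leading coefficients in \<open>x\<^sub>1\<close> and \<open>x\<^sub>2\<close> shows that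
  \<open>Q\<^sub>1\<^sub>2 = g(\<partial>\<^sub>1, \<partial>\<^sub>2) \<Delta>\<close> for a symmetric \<open>g\<close> of degree \<open>k\<close>, where \<open>E\<^sub>a E\<^sub>b \<Delta>\<close> corresponds to
  \<open>x\<^sub>1^a x\<^sub>2^b + x\<^sub>1^b x\<^sub>2^a\<close>. The relations \<open>x\<^sub>1^n = 0\<close> and \<open>h\<^bsub>n-1\<^esub>(x\<^sub>1, x\<^sub>2) = 0\<close> of the coinvariant algebra
  (if \<open>k \<ge> n - 1\<close>) and the harmonicity of \<open>P\<close> in \<open>y\<close> (if \<open>k \<le> n - 2\<close>) reduce \<open>g\<close> to monomials with
  both exponents between \<open>1\<close> and \<open>n - 2\<close>. Evaluating the coefficients of \<open>y\<^sub>1 y\<^sub>2\<close> at suitable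
  monomials shows that the resulting spanning set is independent.
\<close>

section \<open>Functionals on exponent vectors\<close>

text \<open>A polynomial enters as the function \<phi> sending an exponent vector m to m! times the
  coefficient of x^m. Then \<partial>_i^r is precomposition with \<open>shift i r\<close>, and
  harmonicity and alternation become identities between values of \<phi>, proved by reindexing
  finite sums.

  The difficulty is that g need not be determined by Q_12, and that the two ways of shrinking its
  support work in complementary degrees. From degree n - 1 on, the coinvariant relations remove the
  exponent n - 1. Below that they offer nothing, while harmonicity of Q_12 in x still permits x_1^k
  + x_2^k. This polynomial belongs to E_0 E_k \<Delta>, with the excluded operator E_0, and only
  conditions that involve derivatives in y rule it out.

  The tableau polynomials are consecutive differences of the E_j E_i \<Delta> with i \<le> j, apart
  from the last one, hence a unitriangular change of basis.\<close>

definition shift :: "nat \<Rightarrow> nat \<Rightarrow> (nat \<Rightarrow> nat) \<Rightarrow> nat \<Rightarrow> nat" where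
  "shift i r m = m(i := m i + r)"

text \<open>Exponent vectors are total functions on \<open>nat\<close>; this confines \<phi> to the
  variables with index in \<open>I\<close>.\<close>

definition depends_on :: "nat set \<Rightarrow> ((nat \<Rightarrow> nat) \<Rightarrow> rat) \<Rightarrow> bool" where
  "depends_on I \<phi> \<longleftrightarrow> (\<forall>m m'. (\<forall>i\<in>I. m i = m' i) \<longrightarrow> \<phi> m = \<phi> m')"

definition harm_on :: "nat set \<Rightarrow> ((nat \<Rightarrow> nat) \<Rightarrow> rat) \<Rightarrow> bool" where
  "harm_on I \<phi> \<longleftrightarrow> (\<forall>r>0. \<forall>m. (\<Sum>i\<in>I. \<phi> (shift i r m)) = 0)"

definition alt_on :: "nat set \<Rightarrow> ((nat \<Rightarrow> nat) \<Rightarrow> rat) \<Rightarrow> bool" where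
  "alt_on I \<phi> \<longleftrightarrow> (\<forall>i\<in>I. \<forall>j\<in>I. i \<noteq> j \<longrightarrow> (\<forall>m. \<phi> (m \<circ> transpose i j) = - \<phi> m))"

lemma depends_onD: "depends_on I \<phi> \<Longrightarrow> (\<And>i. i \<in> I \<Longrightarrow> m i = m' i) \<Longrightarrow> \<phi> m = \<phi> m'"
  unfolding depends_on_def by blast

lemma harm_onD: "harm_on I \<phi> \<Longrightarrow> r > 0 \<Longrightarrow> (\<Sum>i\<in>I. \<phi> (shift i r m)) = 0"
  unfolding harm_on_def by blast

lemma alt_onD: "alt_on I \<phi> \<Longrightarrow> i \<in> I \<Longrightarrow> j \<in> I \<Longrightarrow> i \<noteq> j \<Longrightarrow> \<phi> (m \<circ> transpose i j) = - \<phi> m"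
  unfolding alt_on_def by blast

lemma alt_on_subset: "alt_on I \<phi> \<Longrightarrow> J \<subseteq> I \<Longrightarrow> alt_on J \<phi>"
  unfolding alt_on_def by blast

lemma shift_commute: "shift i r (shift j s m) = shift j s (shift i r m)"
  by (auto simp: shift_def fun_eq_iff)

lemma shift_shift: "shift i r (shift i s m) = shift i (s + r) m"
  by (auto simp: shift_def fun_eq_iff)

lemma shift_0 [simp]: "shift i 0 m = m"
  by (auto simp: shift_def)

lemma shift_comp_transpose:
  "shift i r (m \<circ> transpose a b) = shift (transpose a b i) r m \<circ> transpose a b"
  by (auto simp: shift_def fun_eq_iff transpose_def)

lemma sum_shift:
  assumes "finite I" "i \<in> I"
  shows "sum (shift i r m) I = sum m I + r"
  using assms by (simp add: shift_def sum.remove[of I i])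

lemma alt_on_eq_0:
  assumes "alt_on I \<phi>" "i \<in> I" "j \<in> I" "i \<noteq> j" "m i = m j"
  shows "\<phi> m = 0"
proof -
  have "m \<circ> transpose i j = m"
    using assms(5) by (auto simp: fun_eq_iff transpose_def)
  with alt_onD[OF assms(1-4), of m] show ?thesis by simp
qed

lemma sum_ge_sum_lessThan:
  assumes "finite (S :: nat set)"
  shows "(\<Sum>i<card S. i) \<le> \<Sum>S"
  using assms
proof (induction "card S" arbitrary: S)
  case (Suc N)
  hence ne: "S \<noteq> {}" by auto
  let ?S = "S - {Max S}"
  have mx: "Max S \<in> S" using ne Suc.prems by auto
  have c: "card ?S = N" using mx Suc by simp
  have "S \<subseteq> {..Max S}" using Suc.prems by auto
  hence "card S \<le> card {..Max S}" by (intro card_mono) auto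
  hence N: "N \<le> Max S" using Suc.hyps(2) by simp
  have "\<Sum>S = Max S + \<Sum>?S" using mx Suc.prems by (simp add: sum.remove)
  moreover have "(\<Sum>i<N. i) \<le> \<Sum>?S" using Suc.hyps(1)[of ?S] c Suc.prems by simp
  ultimately show ?case using N Suc.hyps(2) by (simp flip: Suc.hyps(2))
qed simp

lemma sum_inj_ge:
  assumes "finite I" "inj_on (m :: nat \<Rightarrow> nat) I"
  shows "(\<Sum>i<card I. i) \<le> sum m I"
  using sum_ge_sum_lessThan[of "m ` I"] assms by (simp add: sum.reindex card_image)

text \<open>A power sum is symmetric, so \<open>p\<^sub>r(\<partial>)\<phi>\<close> is again alternating; as it lives in a degree below that
  of every monomial with distinct exponents, it vanishes.\<close>

lemma harm_on_if_alt_on: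
  assumes fin: "finite I" and alt: "alt_on I \<phi>"
    and deg: "\<And>m. \<phi> m \<noteq> 0 \<Longrightarrow> sum m I = (\<Sum>i<card I. i)"
  shows "harm_on I \<phi>"
  unfolding harm_on_def
proof (intro allI impI)
  fix r m assume r: "(r::nat) > 0"
  show "(\<Sum>i\<in>I. \<phi> (shift i r m)) = 0"
  proof (cases "inj_on m I")
    case True
    have "\<phi> (shift i r m) = 0" if "i \<in> I" for i
    proof (rule ccontr)
      assume "\<phi> (shift i r m) \<noteq> 0"
      from deg[OF this] sum_shift[OF fin that, of r m] sum_inj_ge[OF fin True] r
      show False by simp
    qed
    thus ?thesis by simp
  next
    case False
    then obtain a b where ab: "a \<in> I" "b \<in> I" "a \<noteq> b" "m a = m b"
      unfolding inj_on_def by blast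
    \<comment> \<open>A shift at a third index leaves the equal exponents at \<open>a\<close> and
      \<open>b\<close> in place. The two remaining shifts are exchanged by the transposition, so
      their values cancel.\<close>
    have "(\<Sum>i\<in>I. \<phi> (shift i r m)) = (\<Sum>i\<in>{a,b}. \<phi> (shift i r m))"
    proof (rule sum.mono_neutral_right)
      show "\<forall>i\<in>I - {a, b}. \<phi> (shift i r m) = 0"
      proof
        fix i assume "i \<in> I - {a, b}"
        thus "\<phi> (shift i r m) = 0"
          using ab by (intro alt_on_eq_0[OF alt ab(1,2,3)]) (auto simp: shift_def)
      qed
    qed (use fin ab in auto)
    also have "\<dots> = \<phi> (shift a r m) + \<phi> (shift b r m)" using ab by simp
    also have "shift a r m = shift b r m \<circ> transpose a b"
      using ab(4) by (auto simp: shift_def fun_eq_iff transpose_def)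
    also have "\<phi> \<dots> = - \<phi> (shift b r m)" using alt_onD[OF alt ab(1,2,3)] by simp
    finally show ?thesis by simp
  qed
qed

text \<open>\<open>csum \<phi> L k\<close> is \<open>h\<^sub>k(\<partial>\<^sub>i : i \<in> L)\<phi>\<close> for the complete homogeneous symmetric polynomial \<open>h\<^sub>k\<close>.\<close>

fun csum :: "((nat \<Rightarrow> nat) \<Rightarrow> rat) \<Rightarrow> nat list \<Rightarrow> nat \<Rightarrow> (nat \<Rightarrow> nat) \<Rightarrow> rat" where
  "csum \<phi> L 0 m = \<phi> m"
| "csum \<phi> [] (Suc k) m = 0"
| "csum \<phi> (i # L) (Suc k) m = csum \<phi> L (Suc k) m + csum \<phi> (i # L) k (shift i 1 m)"

text \<open>Newton's identity k h_k = \<Sum> p_r h_(k-r) with r = s + 1, read as operators on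
  \<phi>. The recurrence h_k(x_i, L) = h_k(L) + x_i h_(k-1)(x_i, L) behind \<open>csum\<close>
  drives an induction on L and then on k.\<close>

lemma csum_newton:
  assumes "distinct L"
  shows "of_nat k * csum \<phi> L k m = (\<Sum>l\<in>set L. \<Sum>s<k. csum \<phi> L (k - Suc s) (shift l (Suc s) m))"
  using assms
proof (induction L arbitrary: k m)
  case Nil
  show ?case by (cases k) auto
next
  case (Cons i L)
  note outer = Cons.IH[OF distinct.simps(2)[THEN iffD1, OF Cons.prems, THEN conjunct2]]
  have i: "i \<notin> set L" using Cons.prems by simp
  show ?case
  proof (induction k arbitrary: m)
    case (Suc k)
    let ?G = "csum \<phi> (i # L)" and ?H = "csum \<phi> L"
    let ?z = "shift i 1 m"
    have other: "(\<Sum>s<Suc k. ?G (Suc k - Suc s) (shift l (Suc s) m)) =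
        (\<Sum>s<Suc k. ?H (Suc k - Suc s) (shift l (Suc s) m)) + (\<Sum>s<k. ?G (k - Suc s) (shift l (Suc s) ?z))" for l
    proof -
      have "?G (Suc k - Suc s) (shift l (Suc s) m) =
          ?H (Suc k - Suc s) (shift l (Suc s) m) + ?G (k - Suc s) (shift l (Suc s) ?z)" if "s < k" for s
      proof -
        have e: "Suc k - Suc s = Suc (k - Suc s)" using that by simp
        show ?thesis unfolding e csum.simps by (simp add: shift_commute[of i])
      qed
      hence "(\<Sum>s<k. ?G (Suc k - Suc s) (shift l (Suc s) m)) =
        (\<Sum>s<k. ?H (Suc k - Suc s) (shift l (Suc s) m)) + (\<Sum>s<k. ?G (k - Suc s) (shift l (Suc s) ?z))"
        by (simp add: sum.distrib)
      thus ?thesis by simp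
    qed
    have same: "(\<Sum>s<Suc k. ?G (Suc k - Suc s) (shift i (Suc s) m)) =
        ?G k ?z + (\<Sum>s<k. ?G (k - Suc s) (shift i (Suc s) ?z))"
      by (subst sum.lessThan_Suc_shift) (simp add: shift_shift)
    have "of_nat (Suc k) * ?G (Suc k) m = of_nat (Suc k) * ?H (Suc k) m + of_nat k * ?G k ?z + ?G k ?z"
      by (simp add: algebra_simps)
    also have "\<dots> = (\<Sum>l\<in>set L. \<Sum>s<Suc k. ?H (Suc k - Suc s) (shift l (Suc s) m))
        + (\<Sum>l\<in>set (i # L). \<Sum>s<k. ?G (k - Suc s) (shift l (Suc s) ?z)) + ?G k ?z"
      by (simp only: outer Suc.IH)
    also have "\<dots> = (\<Sum>l\<in>set L. \<Sum>s<Suc k. ?G (Suc k - Suc s) (shift l (Suc s) m))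
        + (\<Sum>s<Suc k. ?G (Suc k - Suc s) (shift i (Suc s) m))"
      unfolding same other using i by (simp add: sum.distrib del: csum.simps)
    finally show ?case using i by (simp add: add.commute del: csum.simps)
  qed simp
qed

text \<open>A power sum over \<open>I\<close> commutes with h_k(L), so it still annihilates the
  result.\<close>

lemma csum_sum_shift:
  assumes "harm_on I \<phi>" "r > 0"
  shows "(\<Sum>i\<in>I. csum \<phi> L k (shift i r m)) = 0"
  using assms
proof (induction \<phi> L k m rule: csum.induct)
  case (3 \<phi> l L k m)
  have "(\<Sum>i\<in>I. csum \<phi> (l # L) (Suc k) (shift i r m)) =
      (\<Sum>i\<in>I. csum \<phi> L (Suc k) (shift i r m)) + (\<Sum>i\<in>I. csum \<phi> (l # L) k (shift i r (shift l 1 m)))"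
    unfolding csum.simps shift_commute[of l] by (rule sum.distrib)
  with 3 show ?case by simp
qed (simp_all add: harm_onD)

lemma csum_harm_on:
  assumes "harm_on (set L) \<phi>" "distinct L" "k > 0"
  shows "csum \<phi> L k m = 0"
proof -
  have "of_nat k * csum \<phi> L k m = (\<Sum>s<k. \<Sum>l\<in>set L. csum \<phi> L (k - Suc s) (shift l (Suc s) m))"
    unfolding csum_newton[OF assms(2)] by (rule sum.swap)
  also have "\<dots> = 0" by (simp add: csum_sum_shift[OF assms(1)])
  finally show ?thesis using assms(3) by simp
qed

text \<open>Deleting a variable costs one degree: h_k(L) = h_k(x_i, L) - x_i h_(k-1)(x_i, L). Since
  every h_k of positive degree in all variables annihilates \<phi>, after j deletions those with k >
  j still do.\<close>

lemma csum_suffix: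
  assumes "harm_on (set (K @ L)) \<phi>" "distinct (K @ L)" "k > length K"
  shows "csum \<phi> L k m = 0"
proof -
  have *: "csum \<phi> (drop j (K @ L)) k m = 0" if "j < k" for j
    using that
  proof (induction j arbitrary: k m)
    case 0
    then show ?case using csum_harm_on[OF assms(1,2)] by simp
  next
    case (Suc j)
    then obtain k' where k: "k = Suc k'" "j < k'" by (cases k) auto
    show ?case
    proof (cases "j < length (K @ L)")
      case True
      have d: "drop j (K @ L) = (K @ L) ! j # drop (Suc j) (K @ L)"
        using Cons_nth_drop_Suc[OF True] by simp
      show ?thesis using Suc.IH[of k m] Suc.IH[of k'] k unfolding d by simp
    next
      case False
      thus ?thesis using k by simp
    qed
  qed
  from *[OF assms(3)] show ?thesis by simp
qed

text \<open>The operator form of \<open>x\<^sub>i^n = 0\<close> in the coinvariant algebra.\<close>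

lemma harm_on_eq_0:
  assumes "harm_on I \<phi>" "finite I" "i \<in> I" "m i \<ge> card I"
  shows "\<phi> m = 0"
proof -
  obtain K where K: "set K = I - {i}" "distinct K"
    using finite_distinct_list[of "I - {i}"] assms(2) by auto
  have len: "length K < card I"
    using card_Diff1_less[OF assms(2,3)] K(1) distinct_card[OF K(2)] by simp
  have s: "set (K @ [i]) = I" "distinct (K @ [i])" using K assms(3) by auto
  \<comment> \<open>With one variable left, h_k(x_i) = x_i^k. Only card I - 1 variables were
    deleted, so degree card I is high enough for \<open>csum_suffix\<close>.\<close>
  have single: "csum \<phi> [i] k m' = \<phi> (shift i k m')" for k m'
    by (induction k arbitrary: m') (simp_all add: shift_shift)
  have "csum \<phi> [i] (card I) (m(i := m i - card I)) = 0"
    using csum_suffix[of K "[i]" \<phi> "card I"] s len assms(1) by simp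
  thus ?thesis unfolding single using assms(4) by (simp add: shift_def)
qed

section \<open>Alternating harmonic polynomials in the variables \<open>x\<close>\<close>

text \<open>\<open>D\<close> abstracts the Vandermonde determinant: the coefficient of \<open>x^m\<close>, scaled by \<open>m!\<close>.\<close>

locale staircase =
  fixes n :: nat and D :: "(nat \<Rightarrow> nat) \<Rightarrow> rat"
  assumes D_dep: "depends_on {1..n} D"
    and D_alt: "alt_on {1..n} D"
    and D_deg: "D m \<noteq> 0 \<Longrightarrow> sum m {1..n} = (\<Sum>i=1..n. n - i)"
    and D_stair: "D (\<lambda>i. n - i) = 1"
begin

text \<open>Fixing the exponents of \<open>x\<^sub>1, \<dots>, x\<^bsub>j-1\<^esub>\<close> at \<open>n - 1, n - 2, \<dots>\<close> leaves the Vandermonde determinant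
  in \<open>x\<^sub>j, \<dots>, x\<^sub>n\<close>.\<close>

definition tailD :: "nat \<Rightarrow> (nat \<Rightarrow> nat) \<Rightarrow> rat" where
  "tailD j m = D (\<lambda>i. if i < j then n - i else m i)"

lemma tailD_1: "tailD (Suc 0) = D"
  unfolding tailD_def by (intro ext depends_onD[OF D_dep]) auto

lemma tailD_dep: "depends_on {j..n} (tailD j)"
  unfolding depends_on_def tailD_def by (auto intro!: depends_onD[OF D_dep])

lemma tailD_alt:
  assumes "j \<ge> 1"
  shows "alt_on {j..n} (tailD j)"
  unfolding alt_on_def
proof (intro ballI impI allI)
  fix a b m assume ab: "a \<in> {j..n}" "b \<in> {j..n}" "a \<noteq> b"
  let ?s = "\<lambda>m i. if i < j then n - i else m i :: nat"
  have "?s (m \<circ> transpose a b) = ?s m \<circ> transpose a b"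
    using ab by (auto simp: fun_eq_iff transpose_def)
  moreover have "D (?s m \<circ> transpose a b) = - D (?s m)"
    using ab assms by (intro alt_onD[OF D_alt]) auto
  ultimately show "tailD j (m \<circ> transpose a b) = - tailD j m"
    unfolding tailD_def by simp
qed

lemma sum_stair: "(\<Sum>i=j..n. n - i) = (\<Sum>i<card {j..n}. i)"
  by (rule sum.reindex_bij_witness[of _ "\<lambda>i. n - i" "\<lambda>i. n - i"]) auto

lemma tailD_deg:
  assumes "j \<ge> 1" "j \<le> Suc n" "tailD j m \<noteq> 0"
  shows "sum m {j..n} = (\<Sum>i<card {j..n}. i)"
proof -
  have split: "sum f {1..n} = sum f {1..<j} + sum f {j..n}" for f :: "nat \<Rightarrow> nat"
  proof -
    have "{1..n} = {1..<j} \<union> {j..n}" "{1..<j} \<inter> {j..n} = {}" using assms by auto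
    thus ?thesis by (simp add: sum.union_disjoint)
  qed
  have "sum (\<lambda>i. if i < j then n - i else m i) {1..n} = (\<Sum>i=1..n. n - i)"
    using D_deg assms(3) unfolding tailD_def by blast
  thus ?thesis unfolding split sum_stair by simp
qed

lemma tailD_harm:
  assumes "j \<ge> 1" "j \<le> Suc n"
  shows "harm_on {j..n} (tailD j)"
  using tailD_alt[OF assms(1)] tailD_deg[OF assms] by (intro harm_on_if_alt_on) auto

text \<open>In x_j the Vandermonde determinant of x_j, ..., x_n has degree n - j (bounded by
  \<open>tailD_eq_0\<close>), and its top coefficient is the determinant of the later
  variables.\<close>

lemma tailD_step: "tailD j (m(j := n - j)) = tailD (Suc j) m"
  unfolding tailD_def by (rule arg_cong[of _ _ D]) (auto simp: fun_eq_iff less_Suc_eq)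

lemma tailD_eq_0:
  assumes "j \<ge> 1" "j \<le> n" "m j > n - j"
  shows "tailD j m = 0"
  using assms by (intro harm_on_eq_0[OF tailD_harm, of j j]) auto

end

section \<open>Harmonicity, alternation and dependence under differences and derivatives\<close>

lemma harm_on_diff_sum:
  assumes "harm_on I \<phi>" "\<And>b. b \<in> X \<Longrightarrow> harm_on I (\<psi> b)"
  shows "harm_on I (\<lambda>m. \<phi> m - (\<Sum>b\<in>X. c b * \<psi> b m))"
proof -
  have "(\<Sum>i\<in>I. \<Sum>b\<in>X. c b * \<psi> b (shift i r m)) = 0" if "r > 0" for r m
  proof -
    have "(\<Sum>i\<in>I. \<Sum>b\<in>X. c b * \<psi> b (shift i r m)) = (\<Sum>b\<in>X. \<Sum>i\<in>I. c b * \<psi> b (shift i r m))"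
      by (rule sum.swap)
    also have "\<dots> = (\<Sum>b\<in>X. c b * (\<Sum>i\<in>I. \<psi> b (shift i r m)))"
      by (simp add: sum_distrib_left)
    also have "\<dots> = 0"
      using harm_onD[OF assms(2) that] by simp
    finally show ?thesis .
  qed
  with assms(1) show ?thesis unfolding harm_on_def by (simp add: sum_subtractf)
qed

lemma alt_on_diff_sum:
  assumes "alt_on I \<phi>" "\<And>b. b \<in> X \<Longrightarrow> alt_on I (\<psi> b)"
  shows "alt_on I (\<lambda>m. \<phi> m - (\<Sum>b\<in>X. c b * \<psi> b m))"
  unfolding alt_on_def
proof (intro ballI impI allI)
  fix i j m assume ij: "i \<in> I" "j \<in> I" "i \<noteq> j"
  have "(\<Sum>b\<in>X. c b * \<psi> b (m \<circ> transpose i j)) = (\<Sum>b\<in>X. - (c b * \<psi> b m))"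
    using alt_onD[OF assms(2) ij] by (intro sum.cong) auto
  thus "\<phi> (m \<circ> transpose i j) - (\<Sum>b\<in>X. c b * \<psi> b (m \<circ> transpose i j)) = - (\<phi> m - (\<Sum>b\<in>X. c b * \<psi> b m))"
    using alt_onD[OF assms(1) ij] by (simp add: sum_negf)
qed

lemma depends_on_diff_sum:
  assumes "depends_on I \<phi>" "\<And>b. b \<in> X \<Longrightarrow> depends_on I (\<psi> b)"
  shows "depends_on I (\<lambda>m. \<phi> m - (\<Sum>b\<in>X. c b * \<psi> b m))"
  unfolding depends_on_def
proof (intro allI impI)
  fix m m' assume *: "\<forall>i\<in>I. m i = (m' i :: nat)"
  have "(\<Sum>b\<in>X. c b * \<psi> b m) = (\<Sum>b\<in>X. c b * \<psi> b m')"
    using depends_onD[OF assms(2), of _ m m'] * by (intro sum.cong) auto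
  thus "\<phi> m - (\<Sum>b\<in>X. c b * \<psi> b m) = \<phi> m' - (\<Sum>b\<in>X. c b * \<psi> b m')"
    using depends_onD[OF assms(1), of m m'] * by simp
qed

lemma harm_on_shift: "harm_on I \<phi> \<Longrightarrow> harm_on I (\<lambda>m. \<phi> (shift a s m))"
  unfolding harm_on_def by (simp add: shift_commute[of a])

lemma depends_on_shift: "depends_on I \<phi> \<Longrightarrow> depends_on I (\<lambda>m. \<phi> (shift a s m))"
  unfolding depends_on_def by (simp add: shift_def)

lemma alt_on_shift:
  assumes "alt_on I \<phi>" "i \<notin> I"
  shows "alt_on I (\<lambda>m. \<phi> (shift i r m))"
  unfolding alt_on_def
proof (intro ballI impI allI)
  fix a b m assume ab: "a \<in> I" "b \<in> I" "a \<noteq> b"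
  hence "transpose a b i = i" using assms(2) by (intro transpose_apply_other) auto
  thus "\<phi> (shift i r (m \<circ> transpose a b)) = - \<phi> (shift i r m)"
    using alt_onD[OF assms(1) ab] by (simp add: shift_comp_transpose)
qed

context staircase
begin

text \<open>Peeling off the coefficient of the highest power of \<open>x\<^sub>j\<close>: it is harmonic in the remaining
  variables, and the powers of \<open>\<partial>\<^sub>j\<close> applied to the Vandermonde determinant realise it.\<close>

lemma peel:
  assumes j: "1 \<le> j" "j \<le> n" and A: "A \<subseteq> {Suc j..n}"
    and base: "\<And>\<phi>. harm_on {Suc j..n} \<phi> \<Longrightarrow> depends_on {Suc j..n} \<phi> \<Longrightarrow> alt_on A \<phi> \<Longrightarrow>
      \<exists>c. \<forall>m. \<phi> m = (\<Sum>b\<in>X. c b * tailD (Suc j) (shift (Suc j) b m))"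
    and X: "\<And>b. b \<in> X \<Longrightarrow> alt_on A (\<lambda>m. tailD j (shift (Suc j) b m))"
    and \<phi>: "harm_on {j..n} \<phi>" "depends_on {j..n} \<phi>" "alt_on A \<phi>"
  shows "\<exists>c. \<forall>m. \<phi> m = (\<Sum>a\<le>n - j. \<Sum>b\<in>X. c a b * tailD j (shift j a (shift (Suc j) b m)))"
proof -
  have jA: "j \<notin> A" using A by auto
  have ins: "{j..n} = insert j {Suc j..n}" using j by auto
  have "\<exists>c. \<forall>m. \<phi> m = (\<Sum>a\<le>n - j. \<Sum>b\<in>X. c a b * tailD j (shift j a (shift (Suc j) b m)))"
    if "t \<le> Suc (n - j)" "\<And>m. m j \<ge> t \<Longrightarrow> \<phi> m = 0"
      "harm_on {j..n} \<phi>" "depends_on {j..n} \<phi>" "alt_on A \<phi>" for t \<phi>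
    using that
  proof (induction t arbitrary: \<phi>)
    case 0
    thus ?case by (intro exI[of _ "\<lambda>_ _. 0"]) simp
  next
    case (Suc t)
    note \<phi> = Suc.prems(2-5)
    \<comment> \<open>\<open>t\<close> is the largest exponent of x_j still possible. In the power
      sum identity at \<open>m(j := t)\<close> the term raising this exponent vanishes, so the top
      coefficient is harmonic in the later variables.\<close>
    let ?top = "\<lambda>m. \<phi> (m(j := t))"
    have "harm_on {Suc j..n} ?top"
      unfolding harm_on_def
    proof (intro allI impI)
      fix r m assume r: "(r::nat) > 0"
      have "0 = \<phi> (shift j r (m(j := t))) + (\<Sum>i=Suc j..n. \<phi> (shift i r (m(j := t))))"
        using harm_onD[OF \<phi>(2) r, of "m(j := t)"] unfolding ins by simp
      also have "\<phi> (shift j r (m(j := t))) = 0"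
        using r by (intro \<phi>(1)) (simp add: shift_def)
      also have "(\<Sum>i=Suc j..n. \<phi> (shift i r (m(j := t)))) = (\<Sum>i=Suc j..n. ?top (shift i r m))"
        by (intro sum.cong refl arg_cong[of _ _ \<phi>]) (auto simp: shift_def fun_eq_iff)
      finally show "(\<Sum>i=Suc j..n. ?top (shift i r m)) = 0" by simp
    qed
    moreover have "depends_on {Suc j..n} ?top"
      unfolding depends_on_def ins
      by (auto intro!: depends_onD[OF \<phi>(3)] simp: ins)
    moreover have "alt_on A ?top"
      unfolding alt_on_def
    proof (intro ballI impI allI)
      fix a b m assume ab: "a \<in> A" "b \<in> A" "a \<noteq> b"
      have "(m \<circ> transpose a b)(j := t) = m(j := t) \<circ> transpose a b"
        using ab jA by (auto simp: fun_eq_iff transpose_def)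
      thus "?top (m \<circ> transpose a b) = - ?top m" using alt_onD[OF \<phi>(4) ab, of "m(j := t)"] by metis
    qed
    ultimately obtain c where c: "\<And>m. ?top m = (\<Sum>b\<in>X. c b * tailD (Suc j) (shift (Suc j) b m))"
      using base by blast
    \<comment> \<open>\<open>tailD j\<close> has degree n - j in x_j, so n - j - t derivatives bring
      it down to degree t. In scaled coefficients its top part is then \<open>tailD (Suc j)\<close>
      itself, without a factor.\<close>
    define s where "s = n - j - t"
    let ?B = "\<lambda>b m. tailD j (shift j s (shift (Suc j) b m))"
    define \<psi> where "\<psi> m = \<phi> m - (\<Sum>b\<in>X. c b * ?B b m)" for m
    have \<psi>0: "\<psi> m = 0" if "m j \<ge> t" for m
    proof (cases "m j = t")
      case True
      have "?B b m = tailD (Suc j) (shift (Suc j) b m)" for b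
        using True Suc.prems(1) unfolding s_def
        by (simp add: tailD_step[symmetric]) (rule arg_cong[of _ _ "tailD j"], auto simp: fun_eq_iff shift_def)
      moreover have "\<phi> m = ?top m" using True by (simp add: fun_upd_idem)
      ultimately show ?thesis using c[of m] unfolding \<psi>_def by simp
    next
      case False
      have "?B b m = 0" for b
        using False that Suc.prems(1) j unfolding s_def by (intro tailD_eq_0) (auto simp: shift_def)
      moreover have "\<phi> m = 0" using False that by (intro \<phi>(1)) simp
      ultimately show ?thesis unfolding \<psi>_def by simp
    qed
    have B_harm: "harm_on {j..n} (?B b)" for b
      using j by (intro harm_on_shift tailD_harm) auto
    have B_dep: "depends_on {j..n} (?B b)" for b
      by (intro depends_on_shift tailD_dep)
    have B_alt: "alt_on A (?B b)" if "b \<in> X" for b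
      using alt_on_shift[OF X[OF that] jA, of s] by (simp add: shift_commute[of "Suc j"])
    have "\<exists>c. \<forall>m. \<psi> m = (\<Sum>a\<le>n - j. \<Sum>b\<in>X. c a b * tailD j (shift j a (shift (Suc j) b m)))"
    proof (rule Suc.IH)
      show "harm_on {j..n} \<psi>" unfolding \<psi>_def using B_harm \<phi>(2) by (intro harm_on_diff_sum) auto
      show "depends_on {j..n} \<psi>" unfolding \<psi>_def using B_dep \<phi>(3) by (intro depends_on_diff_sum)
      show "alt_on A \<psi>" unfolding \<psi>_def using B_alt \<phi>(4) by (intro alt_on_diff_sum)
    qed (use Suc.prems(1) \<psi>0 in auto)
    then obtain d where d: "\<And>m. \<psi> m = (\<Sum>a\<le>n - j. \<Sum>b\<in>X. d a b * tailD j (shift j a (shift (Suc j) b m)))"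
      by blast
    have "\<phi> m = (\<Sum>a\<le>n - j. \<Sum>b\<in>X. (d a b + (if a = s then c b else 0)) * tailD j (shift j a (shift (Suc j) b m)))" for m
    proof -
      have "(\<Sum>a\<le>n - j. \<Sum>b\<in>X. (if a = s then c b else 0) * tailD j (shift j a (shift (Suc j) b m)))
          = (\<Sum>a\<le>n - j. if a = s then \<Sum>b\<in>X. c b * tailD j (shift j a (shift (Suc j) b m)) else 0)"
        by (intro sum.cong) auto
      also have "\<dots> = (\<Sum>b\<in>X. c b * ?B b m)" unfolding s_def by simp
      finally show ?thesis using d[of m] unfolding \<psi>_def by (simp add: distrib_right sum.distrib)
    qed
    thus ?case by (intro exI[of _ "\<lambda>a b. d a b + (if a = s then c b else 0)"]) blast
  qed
  \<comment> \<open>The starting bound: \<open>{j..n}\<close> has n - j + 1 elements, so exponents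
    of x_j from n - j + 1 on give zero by \<open>harm_on_eq_0\<close>.\<close>
  from this[of "Suc (n - j)" \<phi>] show ?thesis
    using harm_on_eq_0[OF \<phi>(1), of j] \<phi> j by (simp add: Suc_diff_le)
qed

text \<open>Peeling writes \<phi> as \<Sum> c_a \<partial>_j^a applied to \<open>tailD j\<close>. By
  alternation the same coefficients work with \<partial>_i for every i from j to n. Averaging over i
  turns the powers into power sums, which annihilate \<open>tailD j\<close> for a > 0, so only c_0
  survives.\<close>

lemma alt_harm_tailD:
  assumes "1 \<le> j" "j \<le> Suc n" "harm_on {j..n} \<phi>" "depends_on {j..n} \<phi>" "alt_on {j..n} \<phi>"
  shows "\<exists>c. \<forall>m. \<phi> m = c * tailD j m"
  using assms(2,1,3-5)
proof (induction arbitrary: \<phi> rule: inc_induct)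
  case base
  have "tailD (Suc n) m = 1" for m
    unfolding tailD_def D_stair[symmetric] by (rule depends_onD[OF D_dep]) auto
  moreover have "\<phi> m = \<phi> (\<lambda>_. 0)" for m
    using base by (intro depends_onD[of "{Suc n..n}"]) auto
  ultimately show ?case by (intro exI[of _ "\<phi> (\<lambda>_. 0)"]) simp
next
  case (step j)
  have j: "1 \<le> j" "j \<le> n" using step by auto
  have "\<exists>c. \<forall>m. \<phi> m = (\<Sum>a\<le>n - j. \<Sum>b\<in>{0}. c a b * tailD j (shift j a (shift (Suc j) b m)))"
  proof (rule peel[where j = j and A = "{Suc j..n}" and X = "{0}" and \<phi> = \<phi>, OF j order.refl])
    fix \<psi> assume "harm_on {Suc j..n} \<psi>" "depends_on {Suc j..n} \<psi>" "alt_on {Suc j..n} \<psi>"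
    from step.IH[OF _ this] obtain c where "\<And>m. \<psi> m = c * tailD (Suc j) m" by auto
    thus "\<exists>c. \<forall>m. \<psi> m = (\<Sum>b\<in>{0}. c b * tailD (Suc j) (shift (Suc j) b m))"
      by (intro exI[of _ "\<lambda>_. c"]) simp
  next
    show "alt_on {Suc j..n} (\<lambda>m. tailD j (shift (Suc j) b m))" if "b \<in> {0}" for b
      using that alt_on_subset[OF tailD_alt, of j "{Suc j..n}"] j by auto
  qed (use step alt_on_subset[of "{j..n}" \<phi> "{Suc j..n}"] in auto)
  then obtain c where c: "\<And>m. \<phi> m = (\<Sum>a\<le>n - j. c a * tailD j (shift j a m))" by auto
  have c': "\<phi> m = (\<Sum>a\<le>n - j. c a * tailD j (shift i a m))" if i: "i \<in> {j..n}" for i m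
  proof (cases "i = j")
    case False
    have ij: "i \<in> {j..n}" "j \<in> {j..n}" "i \<noteq> j" using i j False by auto
    have "\<phi> m = - \<phi> (m \<circ> transpose i j)"
      using alt_onD[OF \<open>alt_on {j..n} \<phi>\<close> ij] by simp
    also have "\<dots> = (\<Sum>a\<le>n - j. c a * - tailD j (shift i a m \<circ> transpose i j))"
      unfolding c by (simp add: shift_comp_transpose sum_negf)
    finally show ?thesis using alt_onD[OF tailD_alt[OF j(1)] ij] by simp
  qed (use c in simp)
  have "of_nat (card {j..n}) * \<phi> m = of_nat (card {j..n}) * (c 0 * tailD j m)" for m
  proof -
    have "of_nat (card {j..n}) * \<phi> m = (\<Sum>i\<in>{j..n}. \<phi> m)" by simp
    also have "\<dots> = (\<Sum>i\<in>{j..n}. \<Sum>a\<le>n - j. c a * tailD j (shift i a m))"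
      by (intro sum.cong refl c')
    also have "\<dots> = (\<Sum>a\<le>n - j. \<Sum>i\<in>{j..n}. c a * tailD j (shift i a m))" by (rule sum.swap)
    also have "\<dots> = (\<Sum>a\<le>n - j. if a = 0 then of_nat (card {j..n}) * (c 0 * tailD j m) else 0)"
    proof (intro sum.cong refl)
      fix a
      show "(\<Sum>i\<in>{j..n}. c a * tailD j (shift i a m)) =
        (if a = 0 then of_nat (card {j..n}) * (c 0 * tailD j m) else 0)"
        using harm_onD[OF tailD_harm, of j a m] j by (simp flip: sum_distrib_left)
    qed
    finally show ?thesis by simp
  qed
  thus ?case using j by (intro exI[of _ "c 0"]) simp
qed

lemma alt_harm_tail_tailD:
  assumes "1 \<le> j" "j \<le> n" "harm_on {j..n} \<phi>" "depends_on {j..n} \<phi>" "alt_on {Suc j..n} \<phi>"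
  shows "\<exists>c. \<forall>m. \<phi> m = (\<Sum>a\<le>n - j. c a * tailD j (shift j a m))"
proof -
  have "\<exists>c. \<forall>m. \<phi> m = (\<Sum>a\<le>n - j. \<Sum>b\<in>{0}. c a b * tailD j (shift j a (shift (Suc j) b m)))"
  proof (rule peel[where j = j and A = "{Suc j..n}" and X = "{0}" and \<phi> = \<phi>, OF assms(1,2) order.refl _ _ assms(3-5)])
    fix \<psi> assume "harm_on {Suc j..n} \<psi>" "depends_on {Suc j..n} \<psi>" "alt_on {Suc j..n} \<psi>"
    from alt_harm_tailD[OF _ _ this] obtain c where "\<And>m. \<psi> m = c * tailD (Suc j) m"
      using assms(2) by auto
    thus "\<exists>c. \<forall>m. \<psi> m = (\<Sum>b\<in>{0}. c b * tailD (Suc j) (shift (Suc j) b m))"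
      by (intro exI[of _ "\<lambda>_. c"]) simp
  next
    show "alt_on {Suc j..n} (\<lambda>m. tailD j (shift (Suc j) b m))" if "b \<in> {0}" for b
      using that alt_on_subset[OF tailD_alt, of j "{Suc j..n}"] assms by auto
  qed
  thus ?thesis by auto
qed

text \<open>The top coefficient in x_1 is harmonic in x_2, ..., x_n and alternates in x_3, ..., x_n,
  which is the situation of \<open>alt_harm_tail_tailD\<close>. The bounds n - 1 and n - 2 are the
  degrees of the Vandermonde determinants in x_1 and, once x_1 is gone, in x_2.\<close>

lemma alt_harm_two_tail:
  assumes "2 \<le> n" "harm_on {1..n} \<phi>" "depends_on {1..n} \<phi>" "alt_on {3..n} \<phi>"
  shows "\<exists>c. \<forall>m. \<phi> m = (\<Sum>a\<le>n - 1. \<Sum>b\<le>n - 2. c a b * D (shift 1 a (shift 2 b m)))"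
proof -
  have "\<exists>c. \<forall>m. \<phi> m = (\<Sum>a\<le>n - 1. \<Sum>b\<in>{..n - 2}. c a b * tailD 1 (shift 1 a (shift (Suc 1) b m)))"
  proof (rule peel[where j = 1 and A = "{3..n}" and X = "{..n - 2}" and \<phi> = \<phi>, OF _ _ _ _ _ assms(2-4)])
    fix \<psi> assume "harm_on {Suc 1..n} \<psi>" "depends_on {Suc 1..n} \<psi>" "alt_on {3..n} \<psi>"
    thus "\<exists>c. \<forall>m. \<psi> m = (\<Sum>b\<in>{..n - 2}. c b * tailD (Suc 1) (shift (Suc 1) b m))"
      using alt_harm_tail_tailD[of 2 \<psi>] assms(1) by (simp add: numeral_2_eq_2 numeral_3_eq_3)
  next
    show "alt_on {3..n} (\<lambda>m. tailD 1 (shift (Suc 1) b m))" for b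
      by (intro alt_on_shift alt_on_subset[OF tailD_alt, of 1]) auto
  qed (use assms(1) in auto)
  thus ?thesis by (simp add: tailD_1 numeral_2_eq_2)
qed

end

section \<open>Polynomials in \<partial>_1 and \<partial>_2 applied to the Vandermonde
  determinant\<close>

declare One_nat_def [simp del]

context staircase
begin

lemma D_harm: "harm_on {1..n} D"
  using tailD_harm[of 1] by (simp add: tailD_1[folded One_nat_def])

lemma D_eq_0: "i \<in> {1..n} \<Longrightarrow> m i \<ge> n \<Longrightarrow> D m = 0"
  using harm_on_eq_0[OF D_harm, of i m] by simp

lemma D_sum_tail:
  assumes "n \<ge> 1" "r > 0"
  shows "(\<Sum>i=2..n. D (shift i r m)) = - D (shift 1 r m)"
proof -
  have "{1..n} = insert 1 {2..n}" using assms(1) by auto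
  with harm_onD[OF D_harm assms(2), of m] show ?thesis by simp
qed

text \<open>The relation \<open>h\<^bsub>n-1\<^esub>(x\<^sub>1, x\<^sub>2) = 0\<close> of the coinvariant algebra. With the exponent sum \<open>s\<close> of
  \<open>x\<^sub>1\<close> and \<open>x\<^sub>2\<close> fixed, extending the range of \<open>u\<close> adds only zeros, and the sum over all \<open>u\<close>
  is cancelled by swapping \<open>u\<close> and \<open>s - u\<close>.\<close>

lemma D_complete_sum:
  assumes "n \<ge> 2"
  shows "(\<Sum>u\<le>n - 1. D (shift 1 u (shift 2 (n - 1 - u) m))) = 0"
proof -
  define s where "s = m 1 + m 2 + (n - 1)"
  define f where "f u = D (m(1 := u, 2 := s - u))" for u
  have anti: "f (s - u) = - f u" if "u \<le> s" for u
  proof -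
    have "m(1 := s - u, 2 := s - (s - u)) = m(1 := u, 2 := s - u) \<circ> transpose 1 2"
      using that by (auto simp: fun_eq_iff transpose_def)
    thus ?thesis unfolding f_def using alt_onD[OF D_alt, of 1 2 "m(1 := u, 2 := s - u)"] assms by simp
  qed
  have "(\<Sum>u\<le>s. f u) = (\<Sum>u\<le>s. f (s - u))"
    by (rule sum.reindex_bij_witness[of _ "\<lambda>u. s - u" "\<lambda>u. s - u"]) auto
  also have "\<dots> = (\<Sum>u\<le>s. - f u)" by (intro sum.cong refl anti) simp
  finally have "(\<Sum>u\<le>s. f u) = 0" by (simp add: sum_negf)
  moreover have "(\<Sum>u\<le>s. f u) = (\<Sum>u\<in>{m 1..m 1 + (n - 1)}. f u)"
  proof (rule sum.mono_neutral_right)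
    show "\<forall>u\<in>{..s} - {m 1..m 1 + (n - 1)}. f u = 0"
    proof
      fix u assume "u \<in> {..s} - {m 1..m 1 + (n - 1)}"
      hence "n \<le> s - u \<or> n \<le> u" using assms unfolding s_def by auto
      thus "f u = 0" unfolding f_def
        using D_eq_0[of 2 "m(1 := u, 2 := s - u)"] D_eq_0[of 1 "m(1 := u, 2 := s - u)"] assms by auto
    qed
  qed (auto simp: s_def)
  moreover have "(\<Sum>u\<in>{m 1..m 1 + (n - 1)}. f u) = (\<Sum>u\<le>n - 1. D (shift 1 u (shift 2 (n - 1 - u) m)))"
  proof (rule sum.reindex_bij_witness[of _ "\<lambda>u. m 1 + u" "\<lambda>u. u - m 1"])
    fix u assume "u \<in> {m 1..m 1 + (n - 1)}"
    hence "shift 1 (u - m 1) (shift 2 (n - 1 - (u - m 1)) m) = m(1 := u, 2 := s - u)"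
      unfolding s_def by (auto simp: shift_def fun_eq_iff)
    thus "D (shift 1 (u - m 1) (shift 2 (n - 1 - (u - m 1)) m)) = f u" unfolding f_def by simp
  qed auto
  ultimately show ?thesis by simp
qed

abbreviation DD :: "nat \<Rightarrow> nat \<Rightarrow> (nat \<Rightarrow> nat) \<Rightarrow> rat" where
  "DD a b m \<equiv> D (shift 1 a (shift 2 b m))"

lemma DD_deg:
  assumes "n \<ge> 2" "DD a b m \<noteq> 0"
  shows "sum m {1..n} + a + b = (\<Sum>i=1..n. n - i)"
  using D_deg[OF assms(2)] assms(1) by (simp add: sum_shift)

lemma DD_swap:
  assumes "n \<ge> 2"
  shows "DD a b (m \<circ> transpose 1 2) = - DD b a m"
proof -
  have "shift 1 a (shift 2 b (m \<circ> transpose 1 2)) = shift 1 b (shift 2 a m) \<circ> transpose 1 2"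
    by (auto simp: shift_def fun_eq_iff transpose_def)
  thus ?thesis using alt_onD[OF D_alt, of 1 2] assms by simp
qed

text \<open>The representation from \<open>alt_harm_two_tail\<close> may contain terms of every
  degree. Each \<open>DD a b\<close> is homogeneous, so dropping the terms with a + b \<noteq> k
  does not change \<phi>.\<close>

lemma alt_harm_homogeneous:
  assumes n: "n \<ge> 2" and \<phi>: "harm_on {1..n} \<phi>" "depends_on {1..n} \<phi>" "alt_on {3..n} \<phi>"
    and swap: "\<And>m. \<phi> (m \<circ> transpose 1 2) = - \<phi> m"
    and deg: "\<And>m. \<phi> m \<noteq> 0 \<Longrightarrow> int (sum m {1..n}) = int (\<Sum>i=1..n. n - i) - k"
  shows "if k < 0 then \<forall>m. \<phi> m = 0 else
    \<exists>c. (\<forall>a\<le>nat k. c (nat k - a) = c a) \<and> (\<forall>m. \<phi> m = (\<Sum>a\<le>nat k. c a * DD a (nat k - a) m))"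
proof -
  obtain c where c: "\<And>m. \<phi> m = (\<Sum>a\<le>n - 1. \<Sum>b\<le>n - 2. c a b * DD a b m)"
    using alt_harm_two_tail[OF n \<phi>] by blast
  have c': "\<phi> m = (\<Sum>a\<le>n - 1. \<Sum>b\<le>n - 2. if int (a + b) = k then c a b * DD a b m else 0)" for m
  proof (cases "\<phi> m = 0")
    case False
    have "DD a b m = 0 \<or> int (a + b) = k" for a b
      using DD_deg[OF n, of a b m] deg[OF False] by linarith
    hence "c a b * DD a b m = (if int (a + b) = k then c a b * DD a b m else 0)" for a b
      by (metis mult_zero_right)
    thus ?thesis unfolding c[of m] by (intro sum.cong) auto
  next
    \<comment> \<open>Although \<phi> vanishes at \<open>m\<close>, the degree of \<open>m\<close>
      may be the right one, and then every discarded term is zero. In any other degree every term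
      that is kept is zero.\<close>
    case True
    show ?thesis
    proof (cases "int (sum m {1..n}) = int (\<Sum>i=1..n. n - i) - k")
      case True
      have "DD a b m = 0 \<or> int (a + b) = k" for a b
        using DD_deg[OF n, of a b m] True by linarith
      hence "c a b * DD a b m = (if int (a + b) = k then c a b * DD a b m else 0)" for a b
        by (metis mult_zero_right)
      thus ?thesis unfolding c[of m] by (intro sum.cong) auto
    next
      case False
      have "DD a b m = 0 \<or> int (a + b) \<noteq> k" for a b
        using DD_deg[OF n, of a b m] False by linarith
      hence "(if int (a + b) = k then c a b * DD a b m else 0) = 0" for a b
        by (metis mult_zero_right)
      thus ?thesis using True by (simp only: sum.neutral_const)
    qed
  qed
  show ?thesis
  proof (cases "k < 0")
    case True
    have "\<phi> m = 0" for m unfolding c' using True by (intro sum.neutral ballI) auto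
    thus ?thesis using True by simp
  next
    case False
    define K where "K = nat k"
    have k: "k = int K" using False unfolding K_def by simp
    \<comment> \<open>Coefficient 0 outside a \<le> n - 1 and K - a \<le> n - 2 lets one sum over a
      \<le> K replace the double sum.\<close>
    define e where "e a = (if a \<le> n - 1 \<and> K - a \<le> n - 2 then c a (K - a) else 0)" for a
    have e: "\<phi> m = (\<Sum>a\<le>K. e a * DD a (K - a) m)" for m
    proof -
      have "\<phi> m = (\<Sum>a\<le>n - 1. if a \<le> K then e a * DD a (K - a) m else 0)"
        unfolding c'
      proof (intro sum.cong refl)
        fix a assume a: "a \<in> {..n - 1}"
        have "(\<Sum>b\<le>n - 2. if int (a + b) = k then c a b * DD a b m else 0) =
            (\<Sum>b\<le>n - 2. if b = K - a then (if a \<le> K then c a (K - a) * DD a (K - a) m else 0) else 0)"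
          unfolding k by (intro sum.cong) auto
        also have "\<dots> = (if a \<le> K then e a * DD a (K - a) m else 0)"
          using a unfolding e_def by (subst sum.delta) auto
        finally show "(\<Sum>b\<le>n - 2. if int (a + b) = k then c a b * DD a b m else 0) =
          (if a \<le> K then e a * DD a (K - a) m else 0)" .
      qed
      also have "\<dots> = (\<Sum>a\<in>{..n - 1} \<inter> {..K}. e a * DD a (K - a) m)"
        by (rule sum.mono_neutral_cong_right) auto
      also have "\<dots> = (\<Sum>a\<le>K. e a * DD a (K - a) m)"
        by (rule sum.mono_neutral_left) (auto simp: e_def)
      finally show ?thesis .
    qed
    \<comment> \<open>Exchanging x_1 and x_2 changes the sign of both \<phi> and the determinant.
      Hence the reversed coefficients represent \<phi> as well, and so does the mean.\<close>
    define d where "d a = (e a + e (K - a)) / 2" for a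
    have "\<phi> m = (\<Sum>a\<le>K. d a * DD a (K - a) m)" for m
    proof -
      have "\<phi> m = - \<phi> (m \<circ> transpose 1 2)" using swap by simp
      also have "\<dots> = (\<Sum>a\<le>K. e a * DD (K - a) a m)"
        unfolding e DD_swap[OF n] by (simp add: sum_negf)
      also have "\<dots> = (\<Sum>a\<le>K. e (K - a) * DD a (K - a) m)"
        by (rule sum.reindex_bij_witness[of _ "\<lambda>u. K - u" "\<lambda>u. K - u"]) auto
      finally have "2 * \<phi> m = (\<Sum>a\<le>K. e a * DD a (K - a) m) + (\<Sum>a\<le>K. e (K - a) * DD a (K - a) m)"
        using e[of m] by simp
      also have "\<dots> = 2 * (\<Sum>a\<le>K. d a * DD a (K - a) m)"
        unfolding d_def sum_distrib_left sum.distrib[symmetric]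
        by (intro sum.cong refl) (simp add: field_simps)
      finally show ?thesis by simp
    qed
    moreover have "d (K - a) = d a" if "a \<le> K" for a using that unfolding d_def by simp
    ultimately show ?thesis using False unfolding K_def by auto
  qed
qed

text \<open>Monomials with an exponent \<ge> n vanish on \<open>D\<close>. The remaining bad ones
  have an exponent n - 1, the other being K - (n - 1). By symmetry of \<open>c\<close> both carry
  the coefficient c (n - 1), so a single symmetric multiple of h_(n-1) removes them
  together.\<close>

lemma reduce_high:
  assumes n: "n \<ge> 2" and K: "K \<ge> n - 1" and sym: "\<And>a. a \<le> K \<Longrightarrow> c (K - a) = c a"
  shows "\<exists>d. \<forall>m. (\<Sum>a\<le>K. c a * DD a (K - a) m) =
    (\<Sum>a | 1 \<le> a \<and> a \<le> n - 2 \<and> a < K \<and> K - a \<le> n - 2. d a * DD a (K - a) m)"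
proof -
  define b where "b = K - (n - 1)"
  have Kb: "K = b + (n - 1)" using K unfolding b_def by simp
  \<comment> \<open>\<open>w a\<close> is the coefficient of x_1^a x_2^(K-a) in (x_1^b + x_2^b)
    h_(n-1)(x_1, x_2). It is 2 at the monomials to be removed, whence the factor c (n - 1) / 2 in
    \<open>d\<close>.\<close>
  define w where "w a = (if b \<le> a then 1 else 0) + (if a \<le> n - 1 then 1 else (0::rat))" for a
  define d where "d a = c a - c (n - 1) / 2 * w a" for a
  let ?S = "{a. 1 \<le> a \<and> a \<le> n - 2 \<and> a < K \<and> K - a \<le> n - 2}"
  have w0: "(\<Sum>a\<le>K. w a * DD a (K - a) m) = 0" for m
  proof -
    have "(\<Sum>a\<le>K. w a * DD a (K - a) m) =
      (\<Sum>a\<le>K. if b \<le> a then DD a (K - a) m else 0) + (\<Sum>a\<le>K. if a \<le> n - 1 then DD a (K - a) m else 0)"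
      unfolding w_def sum.distrib[symmetric] by (intro sum.cong) auto
    also have "(\<Sum>a\<le>K. if b \<le> a then DD a (K - a) m else 0) = (\<Sum>a\<in>{b..K}. DD a (K - a) m)"
      by (rule sum.mono_neutral_cong_right) auto
    also have "\<dots> = (\<Sum>u\<le>n - 1. DD u (n - 1 - u) (shift 1 b m))"
    proof (rule sum.reindex_bij_witness[of _ "\<lambda>u. b + u" "\<lambda>u. u - b"])
      fix a assume a: "a \<in> {b..K}"
      hence "K - a = n - 1 - (a - b)" "b + (a - b) = a" unfolding Kb by auto
      thus "DD (a - b) (n - 1 - (a - b)) (shift 1 b m) = DD a (K - a) m"
        by (simp add: shift_commute[of 2 _ 1 b] shift_shift)
    qed (auto simp: Kb)
    also have "\<dots> = 0" by (rule D_complete_sum[OF n])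
    also have "(\<Sum>a\<le>K. if a \<le> n - 1 then DD a (K - a) m else 0) = (\<Sum>a\<le>n - 1. DD a (K - a) m)"
      using K by (intro sum.mono_neutral_cong_right) auto
    also have "\<dots> = (\<Sum>u\<le>n - 1. DD u (n - 1 - u) (shift 2 b m))"
    proof (intro sum.cong refl)
      fix a assume "a \<in> {..n - 1}"
      hence "K - a = b + (n - 1 - a)" unfolding Kb by auto
      thus "DD a (K - a) m = DD a (n - 1 - a) (shift 2 b m)" by (simp add: shift_shift)
    qed
    also have "\<dots> = 0" by (rule D_complete_sum[OF n])
    finally show ?thesis by simp
  qed
  have "(\<Sum>a\<le>K. c a * DD a (K - a) m) = (\<Sum>a\<in>?S. d a * DD a (K - a) m)" for m
  proof -
    have "(\<Sum>a\<le>K. d a * DD a (K - a) m) =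
      (\<Sum>a\<le>K. c a * DD a (K - a) m) - c (n - 1) / 2 * (\<Sum>a\<le>K. w a * DD a (K - a) m)"
      unfolding d_def by (simp add: left_diff_distrib sum_subtractf sum_distrib_left mult.assoc)
    also have "(\<Sum>a\<le>K. d a * DD a (K - a) m) = (\<Sum>a\<in>?S. d a * DD a (K - a) m)"
    proof (rule sum.mono_neutral_right)
      show "\<forall>a\<in>{..K} - ?S. d a * DD a (K - a) m = 0"
      proof
        fix a assume a: "a \<in> {..K} - ?S"
        have big: "DD a (K - a) m = 0" if "a \<ge> n \<or> K - a \<ge> n"
          using that D_eq_0[of 1 "shift 1 a (shift 2 (K - a) m)"] D_eq_0[of 2 "shift 1 a (shift 2 (K - a) m)"] n
          by (auto simp: shift_def)
        \<comment> \<open>An exponent 0 is covered too: the other exponent is then K \<ge> n -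
          1.\<close>
        have "a \<ge> n \<or> K - a \<ge> n \<or> a = n - 1 \<or> K - a = n - 1"
          using a K n by auto
        moreover have "d a = 0" if "a < n" "K - a < n" "a = n - 1 \<or> K - a = n - 1"
        proof -
          have ab: "a = n - 1 \<or> a = b" "a \<le> K" using that(3) a by (auto simp: Kb)
          hence "c a = c (n - 1)"
            using sym[OF K] sym[of a] by (auto simp: b_def)
          moreover have "w a = 2" using that ab unfolding w_def by (auto simp: Kb)
          ultimately show ?thesis unfolding d_def by simp
        qed
        ultimately show "d a * DD a (K - a) m = 0" using big by fastforce
      qed
    qed auto
    finally show ?thesis using w0 by simp
  qed
  thus ?thesis by blast
qed

text \<open>Writing \<open>P = \<Sum> y\<^sub>i y\<^sub>j Q\<^sub>i\<^sub>j\<close>, the conditions \<open>\<Sum> \<partial>x\<^sub>i\<^sup>r \<partial>y\<^sub>i P = 0\<close> for \<open>r = 0, 1\<close> compare two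
  expressions for \<open>\<partial>x\<^sub>1 Q\<^sub>1\<^sub>1\<close>.\<close>

lemma end_coeff_eq_0:
  assumes n: "n \<ge> 2" and K: "K \<le> n - 2"
    and r0: "\<And>m. \<psi> m + (\<Sum>i=2..n. \<Sum>a\<le>K. c a * D (shift 1 a (shift i (K - a) m))) = 0"
    and r1: "\<And>m. \<psi> (shift 1 1 m) + (\<Sum>i=2..n. \<Sum>a\<le>K. c a * D (shift 1 a (shift i (K - a) (shift i 1 m)))) = 0"
  shows "c K = 0"
proof -
  \<comment> \<open>The staircase with the exponent of x_1 lowered by K + 1, which is possible
    because K \<le> n - 2. Moving K + 1 derivatives onto x_1 reaches the staircase, where
    \<open>D\<close> is 1.\<close>
  define m where "m = (\<lambda>i. n - i)(1 := n - 1 - Suc K)"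
  define A where "A = (\<Sum>a\<le>K. c a)"
  have m1: "shift 1 (Suc K) m = (\<lambda>i. n - i)" using K n unfolding m_def by (auto simp: shift_def fun_eq_iff)
  have *: "(\<Sum>i=2..n. \<Sum>a\<le>K. c a * f i a) = (\<Sum>a\<le>K. c a * (\<Sum>i=2..n. f i a))" for f :: "nat \<Rightarrow> nat \<Rightarrow> rat"
    unfolding sum_distrib_left by (rule sum.swap)
  have s: "(\<Sum>i=2..n. D (shift i r (shift 1 a m))) = -1" if "a + r = Suc K" "r > 0" for a r
    using D_sum_tail[OF _ that(2), of "shift 1 a m"] n that(1) by (simp add: shift_shift m1 D_stair)
  have "\<psi> (shift 1 1 m) - A = 0"
  proof -
    have "(\<Sum>a\<le>K. c a * (\<Sum>i=2..n. D (shift 1 a (shift i (K - a) (shift i 1 m))))) = (\<Sum>a\<le>K. c a * -1)"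
    proof (intro sum.cong refl)
      fix a assume "a \<in> {..K}"
      thus "c a * (\<Sum>i=2..n. D (shift 1 a (shift i (K - a) (shift i 1 m)))) = c a * - 1"
        using s[of a "1 + (K - a)"] by (simp add: shift_shift shift_commute[of 1])
    qed
    with r1[of m] show ?thesis unfolding * A_def by (simp add: sum_negf)
  qed
  \<comment> \<open>Now x_i is differentiated K - a times instead of K - a + 1 times. For a = K this
    is zero times, so the n - 1 summands give n - 1 where the power sum relation gave -1. The gap n
    is what isolates c K.\<close>
  moreover have "\<psi> (shift 1 1 m) - A + c K * of_nat n = 0"
  proof -
    have "(\<Sum>a\<le>K. c a * (\<Sum>i=2..n. D (shift 1 a (shift i (K - a) (shift 1 1 m))))) =
      (\<Sum>a\<le>K. - c a + (if a = K then c K * of_nat n else 0))"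
    proof (intro sum.cong refl)
      fix a assume a: "a \<in> {..K}"
      show "c a * (\<Sum>i=2..n. D (shift 1 a (shift i (K - a) (shift 1 1 m)))) =
        - c a + (if a = K then c K * of_nat n else 0)"
      proof (cases "a = K")
        case True
        have "D (shift 1 (1 + K) m) = 1" using m1 D_stair by (metis plus_1_eq_Suc)
        thus ?thesis using True n by (simp add: shift_shift of_nat_diff algebra_simps)
      next
        case False
        thus ?thesis using a s[of "1 + a" "K - a"] by (simp add: shift_shift shift_commute[of 1 a])
      qed
    qed
    also have "\<dots> = - A + c K * of_nat n"
      unfolding A_def by (simp add: sum_subtractf)
    finally show ?thesis using r0[of "shift 1 1 m"] unfolding * by simp
  qed
  ultimately show ?thesis using n by simp
qed

end

section \<open>Scaled coefficients of polynomials\<close>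

lemma lookup_sum_keys:
  "mcoeff P = (\<lambda>m'. \<Sum>m\<in>Poly_Mapping.keys P. if m = m' then mcoeff P m else 0)"
  by (rule ext, subst sum.delta) (simp_all add: in_keys_iff)

lemma poly_eq_sum_single: "P = (\<Sum>m\<in>Poly_Mapping.keys P. Poly_Mapping.single m (mcoeff P m))"
  by (rule poly_mapping_eqI, subst lookup_sum_keys) (simp add: lookup_sum lookup_single when_def)

lemma lookup_scal: "mcoeff (scal c P) m = c * mcoeff P m"
  unfolding scal_def mult_map_scale_conv_mult[symmetric] by (simp add: map.rep_eq when_def)

lemma lookup_pderiv_var:
  "mcoeff (pderiv_var v P) m = of_nat (expo m v + 1) * mcoeff P (m + Poly_Mapping.single v 1)"
proof -
  let ?e = "Poly_Mapping.single v 1 :: mon"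
  have eq: "(of_nat (expo m' v) * mcoeff P m' when m' - ?e = m) =
      (if m' = m + ?e then of_nat (expo m v + 1) * mcoeff P (m + ?e) else 0)" for m'
  proof (cases "expo m' v = 0")
    case True
    have "m' \<noteq> m + ?e" using True by (auto simp: lookup_add)
    thus ?thesis using True by simp
  next
    case False
    have "m' - ?e = m \<longleftrightarrow> m' = m + ?e"
    proof
      assume "m' - ?e = m"
      hence "m + ?e = (m' - ?e) + ?e" by simp
      also have "\<dots> = m'"
        using False by (intro poly_mapping_eqI) (auto simp: lookup_add lookup_minus lookup_single when_def)
      finally show "m' = m + ?e" by simp
    qed simp
    thus ?thesis by (auto simp: lookup_add when_def)
  qed
  have "mcoeff (pderiv_var v P) m =
      (\<Sum>m'\<in>Poly_Mapping.keys P. if m' = m + ?e then of_nat (expo m v + 1) * mcoeff P (m + ?e) else 0)"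
    unfolding pderiv_var_def by (simp add: lookup_sum lookup_single eq del: of_nat_add)
  also have "\<dots> = of_nat (expo m v + 1) * mcoeff P (m + ?e)"
    by (subst sum.delta) (simp_all add: in_keys_iff)
  finally show ?thesis .
qed

lemma lookup_var_mult:
  "mcoeff (var v * P) m = (if expo m v = 0 then 0 else mcoeff P (m - Poly_Mapping.single v 1))"
proof -
  let ?e = "Poly_Mapping.single v 1 :: mon"
  have "var v * P = (\<Sum>m'\<in>Poly_Mapping.keys P. Poly_Mapping.single (?e + m') (mcoeff P m'))"
    unfolding var_def by (subst poly_eq_sum_single[of P]) (simp add: sum_distrib_left mult_single)
  hence *: "mcoeff (var v * P) m = (\<Sum>m'\<in>Poly_Mapping.keys P. mcoeff P m' when ?e + m' = m)"
    by (simp add: lookup_sum lookup_single)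
  show ?thesis
  proof (cases "expo m v = 0")
    case True
    hence "?e + m' \<noteq> m" for m' by (auto simp: lookup_add)
    thus ?thesis using True unfolding * by simp
  next
    case False
    have "?e + (m - ?e) = m"
      using False by (intro poly_mapping_eqI) (auto simp: lookup_add lookup_minus lookup_single when_def)
    hence "?e + m' = m \<longleftrightarrow> m' = m - ?e" for m' by auto
    hence "mcoeff (var v * P) m = (\<Sum>m'\<in>Poly_Mapping.keys P. if m' = m - ?e then mcoeff P m' else 0)"
      unfolding * by (simp add: when_def)
    also have "\<dots> = mcoeff P (m - ?e)"
      by (subst sum.delta) (simp_all add: in_keys_iff)
    finally show ?thesis using False by simp
  qed
qed

lemma var_power: "var v ^ k = Poly_Mapping.single (Poly_Mapping.single v k) 1"
  by (induction k) (simp_all add: var_def mult_single single_add[symmetric] plus_1_eq_Suc)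

lemma prod_single:
  "(\<Prod>i\<in>A. Poly_Mapping.single (f i :: mon) (c i :: rat)) = Poly_Mapping.single (\<Sum>i\<in>A. f i) (\<Prod>i\<in>A. c i)"
  by (induction A rule: infinite_finite_induct) (simp_all add: mult_single)

lemma inj_perm_var:
  assumes "inj \<sigma>"
  shows "inj (perm_var \<sigma>)"
proof (rule injI)
  fix v w assume "perm_var \<sigma> v = perm_var \<sigma> w"
  thus "v = w" using injD[OF assms] by (cases v; cases w) auto
qed

lemma surj_perm_var:
  assumes "surj \<sigma>"
  shows "surj (perm_var \<sigma>)"
  unfolding surj_def
proof
  fix w :: xyvar
  show "\<exists>v. w = perm_var \<sigma> v"
  proof (cases w)
    case (XV j)
    moreover obtain i where "j = \<sigma> i" using assms by blast
    ultimately show ?thesis by (intro exI[of _ "XV i"]) simp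
  next
    case (YV j)
    moreover obtain i where "j = \<sigma> i" using assms by blast
    ultimately show ?thesis by (intro exI[of _ "YV i"]) simp
  qed
qed

text \<open>Pushing exponents forward along \<open>perm_var \<sigma>\<close> and pulling them back
  with \<open>map_key\<close> are mutually inverse, so at most one monomial of P
  contributes.\<close>

lemma lookup_perm_act:
  assumes "bij \<sigma>"
  shows "mcoeff (perm_act \<sigma> P) m = mcoeff P (Poly_Mapping.map_key (perm_var \<sigma>) m)"
proof -
  have inj: "inj (perm_var \<sigma>)" and surj: "surj (perm_var \<sigma>)"
    using assms by (simp_all add: inj_perm_var surj_perm_var bij_is_inj bij_is_surj)
  let ?pm = "\<lambda>m'. \<Sum>v\<in>Poly_Mapping.keys m'. Poly_Mapping.single (perm_var \<sigma> v) (expo m' v)"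
  have pm: "expo (?pm m') (perm_var \<sigma> v) = expo m' v" for m' v
    using inj by (simp add: lookup_sum lookup_single when_def inj_eq in_keys_iff sum.delta)
  have "?pm m' = m \<longleftrightarrow> m' = Poly_Mapping.map_key (perm_var \<sigma>) m" for m'
  proof
    assume "?pm m' = m"
    thus "m' = Poly_Mapping.map_key (perm_var \<sigma>) m"
      using pm[of m'] by (intro poly_mapping_eqI) (auto simp: map_key.rep_eq[OF inj])
  next
    assume m': "m' = Poly_Mapping.map_key (perm_var \<sigma>) m"
    show "?pm m' = m"
    proof (rule poly_mapping_eqI)
      fix w obtain v where "w = perm_var \<sigma> v" using surj by blast
      thus "expo (?pm m') w = expo m w"
        using pm[of m' v] unfolding m' by (simp add: map_key.rep_eq[OF inj])
    qed
  qed
  hence "mcoeff (perm_act \<sigma> P) m =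
      (\<Sum>m'\<in>Poly_Mapping.keys P. if m' = Poly_Mapping.map_key (perm_var \<sigma>) m then mcoeff P m' else 0)"
    unfolding perm_act_def var_power prod_single lookup_sum lookup_scal lookup_single
    by (intro sum.cong) (auto simp: when_def)
  also have "\<dots> = mcoeff P (Poly_Mapping.map_key (perm_var \<sigma>) m)"
    by (subst sum.delta) (simp_all add: in_keys_iff)
  finally show ?thesis .
qed

section \<open>Polynomials in 2n variables as functions of two exponent vectors\<close>

abbreviation xyvars :: "nat \<Rightarrow> xyvar set" where
  "xyvars n \<equiv> XV ` {1..n} \<union> YV ` {1..n}"

lemma polysD: "P \<in> polys n \<Longrightarrow> mcoeff P m \<noteq> 0 \<Longrightarrow> expo m v \<noteq> 0 \<Longrightarrow> v \<in> xyvars n"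
  unfolding polys_def mem_Collect_eq by (meson in_keys_iff subsetD)

lemma polysI: "(\<And>m v. mcoeff P m \<noteq> 0 \<Longrightarrow> expo m v \<noteq> 0 \<Longrightarrow> v \<in> xyvars n) \<Longrightarrow> P \<in> polys n"
  unfolding polys_def by (auto simp: in_keys_iff)

lemma polys_0: "0 \<in> polys n"
  by (rule polysI) simp

lemma polys_add: "P \<in> polys n \<Longrightarrow> Q \<in> polys n \<Longrightarrow> P + Q \<in> polys n"
  by (rule polysI) (metis add.right_neutral lookup_add polysD)

lemma polys_scal: "P \<in> polys n \<Longrightarrow> scal c P \<in> polys n"
  by (rule polysI) (metis lookup_scal mult_zero_right polysD)

lemma polys_sum: "(\<And>i. i \<in> A \<Longrightarrow> f i \<in> polys n) \<Longrightarrow> sum f A \<in> polys n"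
  by (induction A rule: infinite_finite_induct) (auto intro: polys_0 polys_add)

lemma polys_pderiv_var:
  assumes "P \<in> polys n"
  shows "pderiv_var v P \<in> polys n"
proof (rule polysI)
  fix m w assume "mcoeff (pderiv_var v P) m \<noteq> 0" "expo m w \<noteq> 0"
  hence "mcoeff P (m + Poly_Mapping.single v 1) \<noteq> 0" "expo (m + Poly_Mapping.single v 1) w \<noteq> 0"
    by (simp_all add: lookup_pderiv_var lookup_add)
  thus "w \<in> xyvars n" by (rule polysD[OF assms])
qed

lemma polys_pderiv_var_pow: "P \<in> polys n \<Longrightarrow> (pderiv_var v ^^ a) P \<in> polys n"
  by (induction a) (simp_all add: polys_pderiv_var)

lemma polys_var_mult:
  assumes "P \<in> polys n" "v \<in> xyvars n"
  shows "var v * P \<in> polys n"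
proof (rule polysI)
  fix m w assume *: "mcoeff (var v * P) m \<noteq> 0" "expo m w \<noteq> 0"
  hence "mcoeff P (m - Poly_Mapping.single v 1) \<noteq> 0" by (simp add: lookup_var_mult split: if_splits)
  moreover have "expo (m - Poly_Mapping.single v 1) w \<noteq> 0" if "w \<noteq> v"
    using that *(2) by (simp add: lookup_minus lookup_single when_def)
  ultimately show "w \<in> xyvars n" using polysD[OF assms(1)] assms(2) by blast
qed

lemma polys_perm_act:
  assumes "P \<in> polys n" "\<sigma> permutes {1..n}"
  shows "perm_act \<sigma> P \<in> polys n"
proof (rule polysI)
  have b: "bij \<sigma>" using assms(2) by (rule permutes_bij)
  hence inj: "inj (perm_var \<sigma>)" by (simp add: inj_perm_var bij_is_inj)
  fix m w assume *: "mcoeff (perm_act \<sigma> P) m \<noteq> 0" "expo m w \<noteq> 0"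
  obtain v where v: "w = perm_var \<sigma> v" using surj_perm_var[OF bij_is_surj[OF b]] by blast
  have "v \<in> xyvars n"
    using polysD[OF assms(1)] * unfolding lookup_perm_act[OF b] v by (simp add: map_key.rep_eq[OF inj])
  thus "w \<in> xyvars n" unfolding v using permutes_in_image[OF assms(2)] by (auto simp del: atLeastAtMost_iff)
qed

lemma polys_E_op: "P \<in> polys n \<Longrightarrow> E_op n a P \<in> polys n"
  unfolding E_op_def by (intro polys_sum polys_var_mult polys_pderiv_var_pow) auto

definition xymono :: "nat \<Rightarrow> (nat \<Rightarrow> nat) \<Rightarrow> (nat \<Rightarrow> nat) \<Rightarrow> mon" where
  "xymono n u w = (\<Sum>i=1..n. Poly_Mapping.single (XV i) (u i) + Poly_Mapping.single (YV i) (w i))"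

lemma expo_xymono_X: "expo (xymono n u w) (XV j) = (if j \<in> {1..n} then u j else 0)"
  unfolding xymono_def by (simp add: lookup_sum lookup_add lookup_single when_def sum.delta)

lemma expo_xymono_Y: "expo (xymono n u w) (YV j) = (if j \<in> {1..n} then w j else 0)"
  unfolding xymono_def by (simp add: lookup_sum lookup_add lookup_single when_def sum.delta)

lemmas expo_xymono = expo_xymono_X expo_xymono_Y

lemma mon_eqI: "(\<And>j. expo m (XV j) = expo m' (XV j)) \<Longrightarrow> (\<And>j. expo m (YV j) = expo m' (YV j)) \<Longrightarrow> m = m'"
  by (rule poly_mapping_eqI) (metis xyvar.exhaust)

text \<open>The coefficient of \<open>x^u y^w\<close>, scaled by \<open>u! w!\<close> so that differentiation becomes a shift of
  the exponents.\<close>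

definition dcoeff :: "nat \<Rightarrow> qpoly \<Rightarrow> (nat \<Rightarrow> nat) \<Rightarrow> (nat \<Rightarrow> nat) \<Rightarrow> rat" where
  "dcoeff n P u w = mcoeff P (xymono n u w) * (\<Prod>i=1..n. fact (u i) * fact (w i))"

lemma dcoeff_cong:
  assumes "\<And>i. i \<in> {1..n} \<Longrightarrow> u i = u' i" "\<And>i. i \<in> {1..n} \<Longrightarrow> w i = w' i"
  shows "dcoeff n P u w = dcoeff n P u' w'"
  unfolding dcoeff_def xymono_def using assms by simp

lemma dcoeff_0 [simp]: "dcoeff n 0 u w = 0"
  by (simp add: dcoeff_def)

lemma dcoeff_add [simp]: "dcoeff n (P + Q) u w = dcoeff n P u w + dcoeff n Q u w"
  by (simp add: dcoeff_def lookup_add distrib_right)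

lemma dcoeff_diff [simp]: "dcoeff n (P - Q) u w = dcoeff n P u w - dcoeff n Q u w"
  by (simp add: dcoeff_def lookup_minus left_diff_distrib)

lemma dcoeff_scal [simp]: "dcoeff n (scal c P) u w = c * dcoeff n P u w"
  by (simp add: dcoeff_def lookup_scal)

lemma dcoeff_sum [simp]: "dcoeff n (sum f A) u w = (\<Sum>a\<in>A. dcoeff n (f a) u w)"
  by (induction A rule: infinite_finite_induct) simp_all

lemma fact_shift:
  assumes "i \<in> {1..n}"
  shows "(\<Prod>j=1..n. fact (shift i 1 u j) * f j :: rat) = of_nat (u i + 1) * (\<Prod>j=1..n. fact (u j) * f j)"
proof -
  have "(\<Prod>j=1..n. fact (shift i 1 u j) * f j :: rat) =
      (\<Prod>j=1..n. (if j = i then of_nat (u i + 1) else 1) * (fact (u j) * f j))"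
    by (intro prod.cong) (simp_all add: shift_def algebra_simps plus_1_eq_Suc)
  also have "\<dots> = (\<Prod>j=1..n. if j = i then of_nat (u i + 1) else 1) * (\<Prod>j=1..n. fact (u j) * f j)"
    by (rule prod.distrib)
  finally show ?thesis using assms by (simp add: prod.delta)
qed

lemma dcoeff_pderiv_X:
  assumes "i \<in> {1..n}"
  shows "dcoeff n (pderiv_var (XV i) P) u w = dcoeff n P (shift i 1 u) w"
proof -
  have "xymono n u w + Poly_Mapping.single (XV i) 1 = xymono n (shift i 1 u) w"
    using assms by (intro mon_eqI) (auto simp: lookup_add expo_xymono lookup_single shift_def)
  thus ?thesis
    using assms fact_shift[OF assms, of u "\<lambda>j. fact (w j)"]
    by (simp add: dcoeff_def lookup_pderiv_var expo_xymono)
qed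

lemma dcoeff_pderiv_Y:
  assumes "i \<in> {1..n}"
  shows "dcoeff n (pderiv_var (YV i) P) u w = dcoeff n P u (shift i 1 w)"
proof -
  have "xymono n u w + Poly_Mapping.single (YV i) 1 = xymono n u (shift i 1 w)"
    using assms by (intro mon_eqI) (auto simp: lookup_add expo_xymono lookup_single shift_def)
  thus ?thesis
    using assms fact_shift[OF assms, of w "\<lambda>j. fact (u j)"]
    by (simp add: dcoeff_def lookup_pderiv_var expo_xymono mult.commute)
qed

lemma dcoeff_pderiv_X_pow:
  "i \<in> {1..n} \<Longrightarrow> dcoeff n ((pderiv_var (XV i) ^^ a) P) u w = dcoeff n P (shift i a u) w"
  by (induction a arbitrary: u) (simp_all add: dcoeff_pderiv_X shift_shift plus_1_eq_Suc)

lemma dcoeff_pderiv_Y_pow: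
  "i \<in> {1..n} \<Longrightarrow> dcoeff n ((pderiv_var (YV i) ^^ a) P) u w = dcoeff n P u (shift i a w)"
  by (induction a arbitrary: w) (simp_all add: dcoeff_pderiv_Y shift_shift plus_1_eq_Suc)

text \<open>The factor w_i is w_i! / (w_i - 1)!; for w_i = 0 it makes the truncated subtraction
  harmless.\<close>

lemma dcoeff_var_Y:
  assumes "i \<in> {1..n}"
  shows "dcoeff n (var (YV i) * P) u w = of_nat (w i) * dcoeff n P u (w(i := w i - 1))"
proof (cases "w i = 0")
  case True
  thus ?thesis using assms by (simp add: dcoeff_def lookup_var_mult expo_xymono)
next
  case False
  let ?w = "w(i := w i - 1)"
  have w: "shift i 1 ?w = w" using False by (auto simp: shift_def fun_eq_iff)
  have "xymono n u w - Poly_Mapping.single (YV i) 1 = xymono n u ?w"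
    using assms by (intro mon_eqI) (auto simp: lookup_minus expo_xymono lookup_single)
  moreover have "(\<Prod>j=1..n. fact (u j) * fact (w j) :: rat) = of_nat (w i) * (\<Prod>j=1..n. fact (u j) * fact (?w j))"
    using False fact_shift[OF assms, of ?w "\<lambda>j. fact (u j)"] unfolding w
    by (simp add: mult.commute del: fun_upd_apply) simp
  ultimately show ?thesis
    using assms False by (simp add: dcoeff_def lookup_var_mult expo_xymono)
qed

lemma dcoeff_E_op:
  "dcoeff n (E_op n a P) u w = (\<Sum>i=1..n. of_nat (w i) * dcoeff n P (shift i a u) (w(i := w i - 1)))"
  unfolding E_op_def by (simp add: dcoeff_var_Y dcoeff_pderiv_X_pow)

lemma dcoeff_perm_act:
  assumes "\<sigma> permutes {1..n}"
  shows "dcoeff n (perm_act \<sigma> P) u w = dcoeff n P (u \<circ> \<sigma>) (w \<circ> \<sigma>)"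
proof -
  have b: "bij \<sigma>" using assms by (rule permutes_bij)
  hence inj: "inj (perm_var \<sigma>)" by (simp add: inj_perm_var bij_is_inj)
  have "Poly_Mapping.map_key (perm_var \<sigma>) (xymono n u w) = xymono n (u \<circ> \<sigma>) (w \<circ> \<sigma>)"
    using permutes_in_image[OF assms]
    by (intro mon_eqI) (simp_all add: map_key.rep_eq[OF inj] expo_xymono del: atLeastAtMost_iff)
  moreover have "(\<Prod>i=1..n. fact (u i) * fact (w i) :: rat) = (\<Prod>i=1..n. fact (u (\<sigma> i)) * fact (w (\<sigma> i)))"
    using prod.permute[OF assms, of "\<lambda>i. fact (u i) * fact (w i) :: rat"] by (simp add: o_def)
  ultimately show ?thesis by (simp add: dcoeff_def lookup_perm_act[OF b])
qed

lemma xymono_expo: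
  assumes "\<And>v. expo m v \<noteq> 0 \<Longrightarrow> v \<in> xyvars n"
  shows "m = xymono n (\<lambda>i. expo m (XV i)) (\<lambda>i. expo m (YV i))"
proof (rule mon_eqI)
  fix j
  show "expo m (XV j) = expo (xymono n (\<lambda>i. expo m (XV i)) (\<lambda>i. expo m (YV i))) (XV j)"
    using assms[of "XV j"] by (auto simp: expo_xymono image_iff)
  show "expo m (YV j) = expo (xymono n (\<lambda>i. expo m (XV i)) (\<lambda>i. expo m (YV i))) (YV j)"
    using assms[of "YV j"] by (auto simp: expo_xymono image_iff)
qed

lemma dcoeff_eq_0_iff: "dcoeff n P u w = 0 \<longleftrightarrow> mcoeff P (xymono n u w) = 0"
  unfolding dcoeff_def by simp

lemma polys_eq_0I:
  assumes "P \<in> polys n" "\<And>u w. dcoeff n P u w = 0"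
  shows "P = 0"
proof (rule poly_mapping_eqI)
  fix m
  show "mcoeff P m = mcoeff 0 m"
  proof (rule ccontr)
    assume *: "mcoeff P m \<noteq> mcoeff 0 m"
    hence "m = xymono n (\<lambda>i. expo m (XV i)) (\<lambda>i. expo m (YV i))"
      using polysD[OF assms(1)] by (intro xymono_expo) simp
    with * assms(2) show False unfolding dcoeff_eq_0_iff by (metis lookup_zero)
  qed
qed

lemma polys_eq_0_iff: "P \<in> polys n \<Longrightarrow> P = 0 \<longleftrightarrow> (\<forall>u w. dcoeff n P u w = 0)"
  using polys_eq_0I by auto

lemma polys_diff: "P \<in> polys n \<Longrightarrow> Q \<in> polys n \<Longrightarrow> P - Q \<in> polys n"
  by (rule polysI) (metis diff_0_right lookup_minus polysD)

lemma polys_eq_iff: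
  assumes "P \<in> polys n" "Q \<in> polys n"
  shows "P = Q \<longleftrightarrow> (\<forall>u w. dcoeff n P u w = dcoeff n Q u w)"
  using polys_eq_0_iff[OF polys_diff[OF assms]] by simp

lemma diag_harmonic_iff:
  assumes "P \<in> polys n"
  shows "diag_harmonic n P \<longleftrightarrow>
    (\<forall>a b u w. a + b > 0 \<longrightarrow> (\<Sum>i=1..n. dcoeff n P (shift i a u) (shift i b w)) = 0)"
proof -
  have *: "(\<Sum>i=1..n. (pderiv_var (XV i) ^^ a) ((pderiv_var (YV i) ^^ b) P)) = 0 \<longleftrightarrow>
      (\<forall>u w. (\<Sum>i=1..n. dcoeff n P (shift i a u) (shift i b w)) = 0)" for a b
  proof -
    let ?S = "\<Sum>i=1..n. (pderiv_var (XV i) ^^ a) ((pderiv_var (YV i) ^^ b) P)"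
    have c: "dcoeff n ?S u w = (\<Sum>i=1..n. dcoeff n P (shift i a u) (shift i b w))" for u w
      by (simp add: dcoeff_pderiv_X_pow dcoeff_pderiv_Y_pow)
    have "?S = 0 \<longleftrightarrow> (\<forall>u w. dcoeff n ?S u w = 0)"
      using assms by (intro polys_eq_0_iff polys_sum polys_pderiv_var_pow)
    thus ?thesis unfolding c .
  qed
  show ?thesis unfolding diag_harmonic_def
  proof (intro iffI allI impI)
    fix a b :: nat and u w
    assume h: "\<forall>a b. 0 < a + b \<longrightarrow> (\<Sum>i=1..n. (pderiv_var (XV i) ^^ a) ((pderiv_var (YV i) ^^ b) P)) = 0"
      and ab: "0 < a + b"
    show "(\<Sum>i=1..n. dcoeff n P (shift i a u) (shift i b w)) = 0"
      by (rule *[THEN iffD1, OF h[rule_format, OF ab], rule_format])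
  next
    fix a b :: nat
    assume h: "\<forall>a b u w. 0 < a + b \<longrightarrow> (\<Sum>i=1..n. dcoeff n P (shift i a u) (shift i b w)) = 0"
      and ab: "0 < a + b"
    show "(\<Sum>i=1..n. (pderiv_var (XV i) ^^ a) ((pderiv_var (YV i) ^^ b) P)) = 0"
      unfolding * by (intro allI h[rule_format] ab)
  qed
qed

lemma alternating_iff:
  assumes "P \<in> polys n"
  shows "alternating n P \<longleftrightarrow>
    (\<forall>\<sigma> u w. \<sigma> permutes {1..n} \<longrightarrow> dcoeff n P (u \<circ> \<sigma>) (w \<circ> \<sigma>) = of_int (sign \<sigma>) * dcoeff n P u w)"
proof -
  have *: "perm_act \<sigma> P = scal (of_int (sign \<sigma>)) P \<longleftrightarrow>
      (\<forall>u w. dcoeff n P (u \<circ> \<sigma>) (w \<circ> \<sigma>) = of_int (sign \<sigma>) * dcoeff n P u w)"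
    if \<sigma>: "\<sigma> permutes {1..n}" for \<sigma>
    using polys_eq_iff[OF polys_perm_act[OF assms \<sigma>] polys_scal[OF assms]]
    by (simp add: dcoeff_perm_act[OF \<sigma>])
  show ?thesis unfolding alternating_def
  proof (intro iffI allI impI)
    fix \<sigma> u w
    assume "\<forall>\<sigma>. \<sigma> permutes {1..n} \<longrightarrow> perm_act \<sigma> P = scal (of_int (sign \<sigma>)) P" "\<sigma> permutes {1..n}"
    thus "dcoeff n P (u \<circ> \<sigma>) (w \<circ> \<sigma>) = of_int (sign \<sigma>) * dcoeff n P u w"
      using *[of \<sigma>] by simp
  qed (simp add: *)
qed

lemma bihomogeneous_iff:
  assumes "P \<in> polys n"
  shows "bihomogeneous n d e P \<longleftrightarrow>
    (\<forall>u w. dcoeff n P u w \<noteq> 0 \<longrightarrow> int (sum u {1..n}) = d \<and> int (sum w {1..n}) = e)"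
proof
  assume h: "bihomogeneous n d e P"
  show "\<forall>u w. dcoeff n P u w \<noteq> 0 \<longrightarrow> int (sum u {1..n}) = d \<and> int (sum w {1..n}) = e"
  proof (intro allI impI)
    fix u w assume "dcoeff n P u w \<noteq> 0"
    hence "xymono n u w \<in> Poly_Mapping.keys P" by (simp add: dcoeff_eq_0_iff in_keys_iff)
    note h[unfolded bihomogeneous_def, rule_format, OF this]
    moreover have "(\<Sum>i=1..n. expo (xymono n u w) (XV i)) = sum u {1..n}"
      "(\<Sum>i=1..n. expo (xymono n u w) (YV i)) = sum w {1..n}"
      by (simp_all add: expo_xymono)
    ultimately show "int (sum u {1..n}) = d \<and> int (sum w {1..n}) = e"
      by simp
  qed
next
  assume h: "\<forall>u w. dcoeff n P u w \<noteq> 0 \<longrightarrow> int (sum u {1..n}) = d \<and> int (sum w {1..n}) = e"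
  show "bihomogeneous n d e P"
    unfolding bihomogeneous_def
  proof
    fix m assume m: "m \<in> Poly_Mapping.keys P"
    let ?u = "\<lambda>i. expo m (XV i)" and ?w = "\<lambda>i. expo m (YV i)"
    have "m = xymono n ?u ?w" using polysD[OF assms] m by (intro xymono_expo) (simp add: in_keys_iff)
    hence "dcoeff n P ?u ?w \<noteq> 0" using m by (simp add: dcoeff_eq_0_iff in_keys_iff)
    thus "int (\<Sum>i=1..n. expo m (XV i)) = d \<and> int (\<Sum>i=1..n. expo m (YV i)) = e"
      using h by blast
  qed
qed

section \<open>The Vandermonde determinant and the operators \<open>E\<^sub>a\<close>\<close>

lemma xymono_eq_iff: "xymono n u w = xymono n u' w' \<longleftrightarrow> (\<forall>i\<in>{1..n}. u i = u' i \<and> w i = w' i)"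
proof
  assume eq: "xymono n u w = xymono n u' w'"
  show "\<forall>i\<in>{1..n}. u i = u' i \<and> w i = w' i"
  proof
    fix i assume "i \<in> {1..n}"
    thus "u i = u' i \<and> w i = w' i"
      using arg_cong[OF eq, of "\<lambda>m. expo m (XV i)"] arg_cong[OF eq, of "\<lambda>m. expo m (YV i)"]
      by (simp add: expo_xymono)
  qed
qed (simp add: xymono_def)

lemma dcoeff_single:
  "dcoeff n (Poly_Mapping.single (xymono n u' w') c) u w =
    (if \<forall>i\<in>{1..n}. u i = u' i \<and> w i = w' i then c * (\<Prod>i=1..n. fact (u' i) * fact (w' i)) else 0)"
proof (cases "\<forall>i\<in>{1..n}. u i = u' i \<and> w i = w' i")
  case True
  hence "xymono n u w = xymono n u' w'" by (simp add: xymono_eq_iff)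
  moreover have "(\<Prod>i=1..n. fact (u i) * fact (w i) :: rat) = (\<Prod>i=1..n. fact (u' i) * fact (w' i))"
    using True by (intro prod.cong) simp_all
  ultimately show ?thesis using True by (simp add: dcoeff_def)
next
  case False
  hence "xymono n u' w' \<noteq> xymono n u w" unfolding xymono_eq_iff by metis
  thus ?thesis using False by (auto simp: dcoeff_def lookup_single)
qed

lemma polys_single_xymono: "Poly_Mapping.single (xymono n u w) c \<in> polys n"
proof (rule polysI)
  fix m v assume *: "mcoeff (Poly_Mapping.single (xymono n u w) c) m \<noteq> 0" "expo m v \<noteq> 0"
  hence "m = xymono n u w" by (auto simp: lookup_single when_def split: if_splits)
  thus "v \<in> xyvars n" using *(2) by (cases v) (auto simp: expo_xymono split: if_splits)
qed

lemma Delta_poly_eq: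
  "Delta_poly n = (\<Sum>p | p permutes {0..<n}. scal (of_int (sign p))
    (Poly_Mapping.single (xymono n (\<lambda>i. n - 1 - p (i - 1)) (\<lambda>_. 0)) (\<Prod>i=1..n. 1 / fact (n - 1 - p (i - 1)))))"
  unfolding Delta_poly_def
proof (subst det_def'[of _ n], simp, intro sum.cong refl)
  fix p assume "p \<in> {p. p permutes {0..<n}}"
  hence p: "p i < n" if "i < n" for i using that permutes_in_image[of p "{0..<n}" i] by simp
  let ?A = "mat n n (\<lambda>(i', j'). let i = i' + 1; j = j' + 1 in scal (1 / fact (n - j)) (var (XV i) ^ (n - j)))"
  have "(\<Prod>i=0..<n. ?A $$ (i, p i)) =
      (\<Prod>i=0..<n. Poly_Mapping.single (Poly_Mapping.single (XV (i + 1)) (n - 1 - p i)) (1 / fact (n - 1 - p i)))"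
    using p by (intro prod.cong refl) (simp add: Let_def var_power scal_def mult_single add.commute)
  also have "\<dots> = (\<Prod>i=1..n. Poly_Mapping.single (Poly_Mapping.single (XV i) (n - 1 - p (i - 1))) (1 / fact (n - 1 - p (i - 1))))"
    by (rule prod.reindex_bij_witness[of _ "\<lambda>i. i - 1" "\<lambda>i. i + 1"]) auto
  also have "\<dots> = Poly_Mapping.single (xymono n (\<lambda>i. n - 1 - p (i - 1)) (\<lambda>_. 0)) (\<Prod>i=1..n. 1 / fact (n - 1 - p (i - 1)))"
    unfolding prod_single xymono_def by simp
  finally show "of_int (sign p) * (\<Prod>i=0..<n. ?A $$ (i, p i)) =
     scal (of_int (sign p)) (Poly_Mapping.single (xymono n (\<lambda>i. n - 1 - p (i - 1)) (\<lambda>_. 0)) (\<Prod>i=1..n. 1 / fact (n - 1 - p (i - 1))))"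
    by (simp add: scal_def)
qed

lemma polys_Delta_poly: "Delta_poly n \<in> polys n"
  unfolding Delta_poly_eq by (intro polys_sum polys_scal polys_single_xymono)

text \<open>The factorials in the entries of the determinant cancel the scaling of
  \<open>dcoeff\<close>, so a permutation contributes only its sign.\<close>

lemma dcoeff_Delta_poly:
  "dcoeff n (Delta_poly n) u w = (\<Sum>p | p permutes {0..<n}.
    of_int (sign p) * (if \<forall>i\<in>{1..n}. u i = n - 1 - p (i - 1) \<and> w i = 0 then 1 else 0))"
  unfolding Delta_poly_eq dcoeff_sum dcoeff_scal dcoeff_single
proof (intro sum.cong refl arg_cong2[of _ _ _ _ "(*)"] if_cong)
  fix p :: "nat \<Rightarrow> nat"
  show "(\<Prod>i=1..n. 1 / fact (n - 1 - p (i - 1))) * (\<Prod>i=1..n. fact (n - 1 - p (i - 1)) * fact 0) = (1 :: rat)"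
    by (simp add: prod.distrib[symmetric])
qed

definition vdm :: "nat \<Rightarrow> (nat \<Rightarrow> nat) \<Rightarrow> rat" where
  "vdm n u = dcoeff n (Delta_poly n) u (\<lambda>_. 0)"

lemma vdm_eq: "vdm n u = (\<Sum>p | p permutes {0..<n}.
    of_int (sign p) * (if \<forall>i\<in>{1..n}. u i = n - 1 - p (i - 1) then 1 else 0))"
  unfolding vdm_def dcoeff_Delta_poly by simp

lemma dcoeff_Delta_poly_vdm:
  "dcoeff n (Delta_poly n) u w = (if \<forall>i\<in>{1..n}. w i = 0 then vdm n u else 0)"
proof (cases "\<forall>i\<in>{1..n}. w i = 0")
  case True
  thus ?thesis unfolding vdm_def by (auto intro: dcoeff_cong)
next
  case False
  hence "\<not> (\<forall>i\<in>{1..n}. u i = n - 1 - p (i - 1) \<and> w i = 0)" for p by blast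
  thus ?thesis using False unfolding dcoeff_Delta_poly by (simp only:) simp
qed

lemma staircase_vdm: "staircase n (vdm n)"
proof
  show "depends_on {1..n} (vdm n)"
    unfolding depends_on_def vdm_def by (auto intro!: dcoeff_cong)
next
  show "alt_on {1..n} (vdm n)"
    unfolding alt_on_def
  proof (intro ballI impI allI)
    fix a b u assume ab: "a \<in> {1..n}" "b \<in> {1..n}" "a \<noteq> b"
    \<comment> \<open>Variables are numbered from 1 and matrix rows from 0, hence two copies of the
      same transposition.\<close>
    let ?t = "transpose a b" and ?t' = "transpose (a - 1) (b - 1)"
    let ?c = "\<lambda>u p. if \<forall>i\<in>{1..n}. u i = n - 1 - p (i - 1) then 1 else (0 :: rat)"
    have ab': "a - 1 \<in> {0..<n}" "b - 1 \<in> {0..<n}" "a - 1 \<noteq> b - 1" using ab by auto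
    hence t': "?t' permutes {0..<n}" by (intro permutes_swap_id)
    have t: "?t permutes {1..n}" using ab by (intro permutes_swap_id)
    have c: "?c (u \<circ> ?t) (p \<circ> ?t') = ?c u p" for p :: "nat \<Rightarrow> nat"
    proof -
      have "?t' (i - 1) = ?t i - 1" if "i \<in> {1..n}" for i
        using that ab by (auto simp: transpose_def)
      hence "(\<forall>i\<in>{1..n}. (u \<circ> ?t) i = n - 1 - (p \<circ> ?t') (i - 1)) \<longleftrightarrow>
          (\<forall>i\<in>{1..n}. u (?t i) = n - 1 - p (?t i - 1))"
        by simp
      also have "\<dots> \<longleftrightarrow> (\<forall>i\<in>?t ` {1..n}. u i = n - 1 - p (i - 1))" by blast
      finally show ?thesis unfolding permutes_image[OF t] by presburger
    qed
    have "vdm n (u \<circ> ?t) = (\<Sum>p | p permutes {0..<n}. of_int (sign (p \<circ> ?t')) * ?c (u \<circ> ?t) (p \<circ> ?t'))"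
      unfolding vdm_eq by (rule sum_permutations_compose_right[OF t'])
    also have "\<dots> = (\<Sum>p | p permutes {0..<n}. - (of_int (sign p) * ?c u p))"
    proof (intro sum.cong refl)
      fix p assume "p \<in> {p. p permutes {0..<n}}"
      hence "sign (p \<circ> ?t') = - sign p"
        using t' ab'(3) by (subst sign_compose) (auto simp: sign_swap_id intro: permutes_imp_permutation)
      thus "of_int (sign (p \<circ> ?t')) * ?c (u \<circ> ?t) (p \<circ> ?t') = - (of_int (sign p) * ?c u p)"
        unfolding c by simp
    qed
    also have "\<dots> = - vdm n u" unfolding vdm_eq by (rule sum_negf)
    finally show "vdm n (u \<circ> ?t) = - vdm n u" .
  qed
next
  fix u assume "vdm n u \<noteq> 0"
  then obtain p where p: "p permutes {0..<n}" "\<forall>i\<in>{1..n}. u i = n - 1 - p (i - 1)"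
    unfolding vdm_eq by (auto elim!: sum.not_neutral_contains_not_neutral split: if_splits)
  have "sum u {1..n} = (\<Sum>i=1..n. n - 1 - p (i - 1))" using p(2) by (intro sum.cong) auto
  also have "\<dots> = (\<Sum>i\<in>{0..<n}. n - 1 - p i)"
    by (rule sum.reindex_bij_witness[of _ "\<lambda>i. i + 1" "\<lambda>i. i - 1"]) auto
  also have "\<dots> = (\<Sum>i\<in>{0..<n}. n - 1 - i)"
    using sum.permute[OF p(1), of "\<lambda>i. n - 1 - i"] by (simp add: o_def)
  also have "\<dots> = (\<Sum>i=1..n. n - i)"
    by (rule sum.reindex_bij_witness[of _ "\<lambda>i. i - 1" "\<lambda>i. i + 1"]) auto
  finally show "sum u {1..n} = (\<Sum>i=1..n. n - i)" .
next
  have "(\<forall>i\<in>{1..n}. n - i = n - 1 - p (i - 1)) \<longleftrightarrow> p = id" if p: "p permutes {0..<n}" for p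
  proof
    assume h: "\<forall>i\<in>{1..n}. n - i = n - 1 - p (i - 1)"
    show "p = id"
    proof
      fix i show "p i = id i"
      proof (cases "i < n")
        case True
        hence "n - (i + 1) = n - 1 - p i" using h[rule_format, of "i + 1"] by simp
        moreover have "p i < n" using permutes_in_image[OF p, of i] True by simp
        ultimately show ?thesis using True by simp
      next
        case False
        thus ?thesis using permutes_not_in[OF p, of i] by simp
      qed
    qed
  qed auto
  hence "vdm n (\<lambda>i. n - i) = (\<Sum>p | p permutes {0..<n}. if p = id then 1 else 0)"
    unfolding vdm_eq by (intro sum.cong) auto
  also have "\<dots> = 1" by (subst sum.delta) (auto simp: finite_permutations)
  finally show "vdm n (\<lambda>i. n - i) = 1" .
qed

lemma alt_on_permutes:
  assumes "alt_on I \<phi>" "finite I" "\<sigma> permutes I"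
  shows "\<phi> (u \<circ> \<sigma>) = of_int (sign \<sigma>) * \<phi> u"
  using assms(3,2)
proof (induction arbitrary: u rule: permutes_induct)
  case (swap a b p)
  have sgn: "sign (transpose a b \<circ> p) = - sign p"
    using swap assms(2) by (subst sign_compose) (auto simp: sign_swap_id permutation_swap_id intro: permutes_imp_permutation)
  have comp: "\<phi> (u \<circ> (transpose a b \<circ> p)) = of_int (sign p) * \<phi> (u \<circ> transpose a b)"
    using swap.IH[of "u \<circ> transpose a b"] by (simp only: comp_assoc)
  show ?case unfolding comp sgn alt_onD[OF assms(1) swap(1,2,3)] by simp
qed simp

lemma sum_stair_eq: "int (\<Sum>i=1..n. n - i) = int n * (int n - 1) div 2"
proof -
  have "2 * int (\<Sum>i=1..n. n - i) = int n * (int n - 1)"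
  proof (induction n)
    case (Suc n)
    have "(\<Sum>i=1..Suc n. Suc n - i) = (\<Sum>i=1..n. Suc n - i)" by simp
    also have "\<dots> = (\<Sum>i=1..n. n - i + 1)" by (intro sum.cong) auto
    also have "\<dots> = (\<Sum>i=1..n. n - i) + n" by (simp only: sum.distrib) simp
    finally show ?case using Suc by (simp add: algebra_simps)
  qed simp
  thus ?thesis by linarith
qed

lemma alt_harm_bi_iff:
  "P \<in> alt_harm_bi n k l \<longleftrightarrow> P \<in> polys n \<and>
    (\<forall>a b u w. a + b > 0 \<longrightarrow> (\<Sum>i=1..n. dcoeff n P (shift i a u) (shift i b w)) = 0) \<and>
    (\<forall>\<sigma> u w. \<sigma> permutes {1..n} \<longrightarrow> dcoeff n P (u \<circ> \<sigma>) (w \<circ> \<sigma>) = of_int (sign \<sigma>) * dcoeff n P u w) \<and>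
    (\<forall>u w. dcoeff n P u w \<noteq> 0 \<longrightarrow> int (sum u {1..n}) = int (\<Sum>i=1..n. n - i) - k \<and> int (sum w {1..n}) = l)"
proof (cases "P \<in> polys n")
  case True
  show ?thesis
    unfolding alt_harm_bi_def alt_harm_def mem_Collect_eq sum_stair_eq diag_harmonic_iff[OF True]
      alternating_iff[OF True] bihomogeneous_iff[OF True] conj_assoc ..
qed (simp add: alt_harm_bi_def alt_harm_def)

lemma alt_harm_biD:
  assumes "P \<in> alt_harm_bi n k l"
  shows "P \<in> polys n"
    and "a + b > 0 \<Longrightarrow> (\<Sum>i=1..n. dcoeff n P (shift i a u) (shift i b w)) = 0"
    and "\<sigma> permutes {1..n} \<Longrightarrow> dcoeff n P (u \<circ> \<sigma>) (w \<circ> \<sigma>) = of_int (sign \<sigma>) * dcoeff n P u w"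
    and "dcoeff n P u w \<noteq> 0 \<Longrightarrow> int (sum u {1..n}) = int (\<Sum>i=1..n. n - i) - k"
    and "dcoeff n P u w \<noteq> 0 \<Longrightarrow> int (sum w {1..n}) = l"
proof -
  note h = assms[unfolded alt_harm_bi_iff]
  note deg = h[THEN conjunct2, THEN conjunct2, THEN conjunct2, rule_format]
  show "P \<in> polys n" by (rule h[THEN conjunct1])
  show "a + b > 0 \<Longrightarrow> (\<Sum>i=1..n. dcoeff n P (shift i a u) (shift i b w)) = 0"
    by (rule h[THEN conjunct2, THEN conjunct1, rule_format])
  show "\<sigma> permutes {1..n} \<Longrightarrow> dcoeff n P (u \<circ> \<sigma>) (w \<circ> \<sigma>) = of_int (sign \<sigma>) * dcoeff n P u w"
    by (rule h[THEN conjunct2, THEN conjunct2, THEN conjunct1, rule_format])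
  show "dcoeff n P u w \<noteq> 0 \<Longrightarrow> int (sum u {1..n}) = int (\<Sum>i=1..n. n - i) - k"
    by (rule deg[THEN conjunct1])
  show "dcoeff n P u w \<noteq> 0 \<Longrightarrow> int (sum w {1..n}) = l"
    by (rule deg[THEN conjunct2])
qed

lemma Delta_poly_in_alt_harm_bi: "Delta_poly n \<in> alt_harm_bi n 0 0"
  unfolding alt_harm_bi_iff
proof (intro conjI allI impI)
  interpret staircase n "vdm n" by (rule staircase_vdm)
  fix u w
  show "(\<Sum>i=1..n. dcoeff n (Delta_poly n) (shift i a u) (shift i b w)) = 0" if "a + b > 0" for a b
  proof (cases "b = 0 \<and> (\<forall>i\<in>{1..n}. w i = 0)")
    case True
    thus ?thesis using harm_onD[OF D_harm, of a u] that by (simp add: dcoeff_Delta_poly_vdm)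
  next
    case False
    hence "\<not> (\<forall>j\<in>{1..n}. shift i b w j = 0)" if "i \<in> {1..n}" for i
      using that by (auto simp: shift_def)
    hence "dcoeff n (Delta_poly n) (shift i a u) (shift i b w) = 0" if "i \<in> {1..n}" for i
      using that unfolding dcoeff_Delta_poly_vdm by presburger
    thus ?thesis by simp
  qed
  show "dcoeff n (Delta_poly n) (u \<circ> \<sigma>) (w \<circ> \<sigma>) = of_int (sign \<sigma>) * dcoeff n (Delta_poly n) u w"
    if \<sigma>: "\<sigma> permutes {1..n}" for \<sigma>
  proof -
    have "(\<forall>i\<in>{1..n}. (w \<circ> \<sigma>) i = 0) \<longleftrightarrow> (\<forall>i\<in>\<sigma> ` {1..n}. w i = 0)" by simp
    thus ?thesis unfolding dcoeff_Delta_poly_vdm permutes_image[OF \<sigma>]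
      using alt_on_permutes[OF D_alt _ \<sigma>, of u] by simp
  qed
  assume "dcoeff n (Delta_poly n) u w \<noteq> 0"
  hence *: "vdm n u \<noteq> 0" "\<forall>i\<in>{1..n}. w i = 0"
    unfolding dcoeff_Delta_poly_vdm by (simp_all split: if_splits)
  show "int (sum u {1..n}) = int (\<Sum>i=1..n. n - i) - 0" using D_deg[OF *(1)] by simp
  show "int (sum w {1..n}) = 0" using *(2) by simp
qed (rule polys_Delta_poly)

text \<open>The commutator of \<Sum>_j \<partial>x_j^c \<partial>y_j^d with E_a is d \<Sum>_j
  \<partial>x_j^(c+a) \<partial>y_j^(d-1), again one of the annihilating operators, of positive
  order because a > 0.\<close>

lemma E_op_in_alt_harm_bi:
  assumes P: "P \<in> alt_harm_bi n k l" and a: "a > 0"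
  shows "E_op n a P \<in> alt_harm_bi n (k + int a) (l + 1)"
proof -
  note P1 = alt_harm_biD(1)[OF P] and P2 = alt_harm_biD(2)[OF P] and P3 = alt_harm_biD(3)[OF P]
    and P4 = alt_harm_biD(4,5)[OF P]
  show ?thesis
    unfolding alt_harm_bi_iff
  proof (intro conjI allI impI)
    show "E_op n a P \<in> polys n" using P1 by (rule polys_E_op)
  next
    fix c d u w assume cd: "(c :: nat) + d > 0"
    \<comment> \<open>\<open>?T\<close> is E_a after the differentiation, and \<open>?S\<close>
      arises where \<partial>y_j^d hits the factor y_j. Its factor d covers d = 0 in spite of the
      truncated \<open>d - 1\<close>.\<close>
    let ?T = "\<lambda>i j. of_nat (w i) * dcoeff n P (shift j c (shift i a u)) (shift j d (w(i := w i - 1)))"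
    let ?S = "\<lambda>j. of_nat d * dcoeff n P (shift j (c + a) u) (shift j (d - 1) w)"
    have split: "of_nat (shift j d w i) * dcoeff n P (shift i a (shift j c u)) ((shift j d w)(i := shift j d w i - 1))
        = ?T i j + (if i = j then ?S j else 0)" for i j
    proof (cases "i = j")
      case True
      let ?Q = "dcoeff n P (shift i (c + a) u) (w(i := w i + d - 1))"
      have e1: "of_nat (w i) * ?Q = ?T i i"
      proof (cases "w i = 0")
        case False
        hence "shift i d (w(i := w i - 1)) = w(i := w i + d - 1)" by (auto simp: shift_def)
        thus ?thesis by (simp add: shift_shift add.commute)
      qed simp
      have e2: "of_nat d * ?Q = ?S i"
        by (cases "d = 0") (auto simp: shift_def)
      have e3: "(shift i d w)(i := w i + d - 1) = w(i := w i + d - 1)" "shift i d w i = w i + d"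
        by (auto simp: shift_def)
      have "of_nat (shift i d w i) * dcoeff n P (shift i a (shift i c u)) ((shift i d w)(i := shift i d w i - 1))
          = (of_nat (w i) + of_nat d) * ?Q"
        unfolding e3 shift_shift by simp
      also have "\<dots> = ?T i i + ?S i" unfolding distrib_right e1 e2 ..
      finally show ?thesis using True by simp
    next
      case False
      hence "(shift j d w)(i := shift j d w i - 1) = shift j d (w(i := w i - 1))" "shift j d w i = w i"
        by (auto simp: shift_def fun_eq_iff)
      thus ?thesis using False by (simp add: shift_commute[of i])
    qed
    have "(\<Sum>j=1..n. dcoeff n (E_op n a P) (shift j c u) (shift j d w)) =
        (\<Sum>j=1..n. \<Sum>i=1..n. ?T i j) + (\<Sum>j=1..n. ?S j)"
      unfolding dcoeff_E_op split sum.distrib by (intro arg_cong2[of _ _ _ _ "(+)"] sum.cong refl) simp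
    also have "(\<Sum>j=1..n. \<Sum>i=1..n. ?T i j) = (\<Sum>i=1..n. \<Sum>j=1..n. ?T i j)" by (rule sum.swap)
    also have "\<dots> = 0" using P2[OF cd] by (simp flip: sum_distrib_left)
    also have "(\<Sum>j=1..n. ?S j) = 0" using P2[of "c + a" "d - 1"] a by (simp flip: sum_distrib_left)
    finally show "(\<Sum>j=1..n. dcoeff n (E_op n a P) (shift j c u) (shift j d w)) = 0" by simp
  next
    fix \<sigma> u w assume \<sigma>: "\<sigma> permutes {1..n}"
    let ?F = "\<lambda>i. of_nat (w i) * dcoeff n P (shift i a u) (w(i := w i - 1))"
    have eq: "of_nat ((w \<circ> \<sigma>) i) * dcoeff n P (shift i a (u \<circ> \<sigma>)) ((w \<circ> \<sigma>)(i := (w \<circ> \<sigma>) i - 1)) =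
        of_int (sign \<sigma>) * (?F \<circ> \<sigma>) i" for i
    proof -
      have "shift i a (u \<circ> \<sigma>) = shift (\<sigma> i) a u \<circ> \<sigma>"
        "(w \<circ> \<sigma>)(i := (w \<circ> \<sigma>) i - 1) = w(\<sigma> i := w (\<sigma> i) - 1) \<circ> \<sigma>"
        using permutes_inj[OF \<sigma>] by (auto simp: shift_def fun_eq_iff inj_eq)
      thus ?thesis using P3[OF \<sigma>] by simp
    qed
    have "dcoeff n (E_op n a P) (u \<circ> \<sigma>) (w \<circ> \<sigma>) = of_int (sign \<sigma>) * (\<Sum>i=1..n. (?F \<circ> \<sigma>) i)"
      unfolding dcoeff_E_op eq by (rule sum_distrib_left[symmetric])
    also have "(\<Sum>i=1..n. (?F \<circ> \<sigma>) i) = (\<Sum>i=1..n. ?F i)"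
      using sum.permute[OF \<sigma>, of ?F] by simp
    finally show "dcoeff n (E_op n a P) (u \<circ> \<sigma>) (w \<circ> \<sigma>) = of_int (sign \<sigma>) * dcoeff n (E_op n a P) u w"
      unfolding dcoeff_E_op .
  next
    fix u w assume "dcoeff n (E_op n a P) u w \<noteq> 0"
    then obtain i where i: "i \<in> {1..n}" "w i \<noteq> 0" "dcoeff n P (shift i a u) (w(i := w i - 1)) \<noteq> 0"
      unfolding dcoeff_E_op by (auto elim!: sum.not_neutral_contains_not_neutral)
    let ?w = "w(i := w i - 1)"
    have "shift i 1 ?w = w" using i(2) by (auto simp: shift_def)
    hence "sum w {1..n} = sum ?w {1..n} + 1" using sum_shift[of "{1..n}" i 1 ?w] i(1) by simp
    thus "int (sum w {1..n}) = l + 1" using P4(2)[OF i(3)] by linarith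
    show "int (sum u {1..n}) = int (\<Sum>i=1..n. n - i) - (k + int a)"
      using P4(1)[OF i(3)] sum_shift[OF finite_atLeastAtMost i(1), of a u] by linarith
  qed
qed

section \<open>Degree two in the variables \<open>y\<close>\<close>

abbreviation yy :: "nat \<Rightarrow> nat \<Rightarrow> nat \<Rightarrow> nat" where
  "yy i j \<equiv> shift i 1 (shift j 1 (\<lambda>_. 0))"

lemma sum_support_pair:
  assumes "finite I" "i \<in> I" "j \<in> I" "i \<noteq> j" "\<And>l. l \<in> I \<Longrightarrow> l \<noteq> i \<Longrightarrow> l \<noteq> j \<Longrightarrow> f l = 0"
  shows "sum f I = f i + f j"
proof -
  have "sum f I = sum f {i, j}" using assms by (intro sum.mono_neutral_right) auto
  thus ?thesis using assms(4) by simp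
qed

lemma dcoeff_E_op_Delta:
  assumes "j \<in> {1..n}"
  shows "dcoeff n (E_op n b (Delta_poly n)) u (shift j 1 (\<lambda>_. 0)) = vdm n (shift j b u)"
proof -
  let ?w = "shift j 1 (\<lambda>_. 0)"
  have "dcoeff n (E_op n b (Delta_poly n)) u ?w =
      (\<Sum>i=1..n. if i = j then vdm n (shift j b u) else 0)"
    unfolding dcoeff_E_op
  proof (intro sum.cong refl)
    fix i
    have "(shift j 1 (\<lambda>_. 0))(j := 0) = (\<lambda>_. 0)" by (auto simp: shift_def)
    thus "of_nat (?w i) * dcoeff n (Delta_poly n) (shift i b u) (?w(i := ?w i - 1)) =
        (if i = j then vdm n (shift j b u) else 0)"
      by (cases "i = j") (simp_all add: shift_def vdm_def)
  qed
  thus ?thesis using assms by simp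
qed

lemma dcoeff_E_op_E_op_Delta:
  assumes "i \<in> {1..n}" "j \<in> {1..n}" "i \<noteq> j"
  shows "dcoeff n (E_op n a (E_op n b (Delta_poly n))) u (yy i j) =
    vdm n (shift i a (shift j b u)) + vdm n (shift j a (shift i b u))"
proof -
  let ?F = "\<lambda>l. of_nat (yy i j l) * dcoeff n (E_op n b (Delta_poly n)) (shift l a u) ((yy i j)(l := yy i j l - 1))"
  have "sum ?F {1..n} = ?F i + ?F j"
    using assms by (intro sum_support_pair) (auto simp: shift_def)
  moreover have "yy i j i = 1" "yy i j j = 1" "(yy i j)(i := 0) = shift j 1 (\<lambda>_. 0)" "(yy i j)(j := 0) = shift i 1 (\<lambda>_. 0)"
    using assms(3) by (auto simp: shift_def fun_eq_iff)
  ultimately show ?thesis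
    unfolding dcoeff_E_op[of n a]
    by (simp add: dcoeff_E_op_Delta[OF assms(1)] dcoeff_E_op_Delta[OF assms(2)] shift_commute[of j b i a] shift_commute[of i b j a])
qed

lemma E_op_commute:
  assumes "P \<in> polys n"
  shows "E_op n a (E_op n b P) = E_op n b (E_op n a P)"
proof -
  let ?w = "\<lambda>w i. w(i := w i - 1 :: nat)"
  have "dcoeff n (E_op n a (E_op n b P)) u w = dcoeff n (E_op n b (E_op n a P)) u w" for u w
  proof -
    have swap: "of_nat (w i) * (of_nat (?w w i j) * dcoeff n P (shift j b (shift i a u)) (?w (?w w i) j)) =
        of_nat (w j) * (of_nat (?w w j i) * dcoeff n P (shift i a (shift j b u)) (?w (?w w j) i))" for i j
    proof (cases "i = j")
      case False
      hence "?w (?w w i) j = ?w (?w w j) i" by (auto simp: fun_eq_iff)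
      thus ?thesis using False by (simp add: shift_commute[of j])
    qed (simp add: shift_shift add.commute)
    have "dcoeff n (E_op n a (E_op n b P)) u w =
        (\<Sum>i=1..n. \<Sum>j=1..n. of_nat (w i) * (of_nat (?w w i j) * dcoeff n P (shift j b (shift i a u)) (?w (?w w i) j)))"
      unfolding dcoeff_E_op sum_distrib_left ..
    also have "\<dots> = (\<Sum>i=1..n. \<Sum>j=1..n. of_nat (w j) * (of_nat (?w w j i) * dcoeff n P (shift i a (shift j b u)) (?w (?w w j) i)))"
      by (intro sum.cong refl swap)
    also have "\<dots> = (\<Sum>j=1..n. \<Sum>i=1..n. of_nat (w j) * (of_nat (?w w j i) * dcoeff n P (shift i a (shift j b u)) (?w (?w w j) i)))"
      by (rule sum.swap)
    also have "\<dots> = dcoeff n (E_op n b (E_op n a P)) u w"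
      unfolding dcoeff_E_op sum_distrib_left ..
    finally show ?thesis .
  qed
  thus ?thesis using polys_eq_iff[OF polys_E_op[OF polys_E_op[OF assms]] polys_E_op[OF polys_E_op[OF assms]]] by blast
qed

lemma dcoeff_transpose:
  assumes P: "P \<in> alt_harm_bi n k l" and ab: "a \<in> {1..n}" "b \<in> {1..n}" "a \<noteq> b"
  shows "dcoeff n P (u \<circ> transpose a b) (yy i j) = - dcoeff n P u (yy (transpose a b i) (transpose a b j))"
proof -
  let ?t = "transpose a b"
  have t: "?t permutes {1..n}" using ab by (intro permutes_swap_id)
  have "yy i j = shift i 1 (shift j 1 ((\<lambda>_. 0) \<circ> ?t))" by (simp add: comp_def)
  also have "\<dots> = yy (?t i) (?t j) \<circ> ?t" unfolding shift_comp_transpose ..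
  finally have "dcoeff n P (u \<circ> ?t) (yy i j) = of_int (sign ?t) * dcoeff n P u (yy (?t i) (?t j))"
    using alt_harm_biD(3)[OF P t] by (simp only:)
  thus ?thesis using ab(3) by (simp add: sign_swap_id)
qed

lemma sum_pos_obtain:
  assumes "sum (w :: nat \<Rightarrow> nat) I = Suc k" "finite I"
  obtains i w' where "i \<in> I" "w = shift i 1 w'" "sum w' I = k"
proof -
  have "sum w I \<noteq> 0" using assms(1) by simp
  then obtain i where i: "i \<in> I" "w i \<noteq> 0" by (rule sum.not_neutral_contains_not_neutral)
  have w: "w = shift i 1 (w(i := w i - 1))" using i(2) by (auto simp: shift_def)
  hence "sum w I = sum (w(i := w i - 1)) I + 1" using sum_shift[OF assms(2) i(1)] by metis
  with that[OF i(1) w] assms(1) show ?thesis by simp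
qed

text \<open>Alternation moves \<open>y\<^sub>1 y\<^sub>2\<close> to any \<open>y\<^sub>i y\<^sub>j\<close> with \<open>i \<noteq> j\<close>, and \<open>\<Sum> \<partial>y\<^sub>i P = 0\<close> then controls
  the squares.\<close>

lemma alt_harm_bi_2_eq_0:
  assumes n: "n \<ge> 2" and P: "P \<in> alt_harm_bi n k 2" and 12: "\<And>u. dcoeff n P u (yy 1 2) = 0"
  shows "P = 0"
proof (rule polys_eq_0I[OF alt_harm_biD(1)[OF P]])
  have one: "dcoeff n P u (yy 1 j) = 0" if "j \<in> {1..n}" "j \<noteq> 1" for j u
  proof (cases "j = 2")
    case False
    thus ?thesis using dcoeff_transpose[OF P, of 2 j u 1 2] 12[of "u \<circ> transpose 2 j"] n that by simp
  qed (use 12 in simp)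
  have off: "dcoeff n P u (yy i j) = 0" if ij: "i \<in> {1..n}" "j \<in> {1..n}" "i \<noteq> j" for i j u
  proof (cases "i = 1")
    case False
    show ?thesis
    proof (cases "j = 1")
      case True
      thus ?thesis using one[OF ij(1) False, of u] by (simp add: shift_commute[of i])
    next
      case j: False
      thus ?thesis using dcoeff_transpose[OF P, of 1 i u 1 j] one[OF ij(2) j, of "u \<circ> transpose 1 i"] ij False n
        by simp
    qed
  qed (use one ij in simp)
  have diag: "dcoeff n P u (yy j j) = 0" if j: "j \<in> {1..n}" for j u
  proof -
    have "(\<Sum>i=1..n. dcoeff n P u (yy i j)) = 0"
      using alt_harm_biD(2)[OF P, of 0 1 u "shift j 1 (\<lambda>_. 0)"] by simp
    also have "(\<Sum>i=1..n. dcoeff n P u (yy i j)) = (\<Sum>i=1..n. if i = j then dcoeff n P u (yy j j) else 0)"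
      using off j by (intro sum.cong) auto
    finally show ?thesis using j by simp
  qed
  fix u w
  show "dcoeff n P u w = 0"
  proof (rule ccontr)
    assume ne: "dcoeff n P u w \<noteq> 0"
    have "sum w {1..n} = Suc (Suc 0)" using alt_harm_biD(5)[OF P ne] by linarith
    then obtain i w' where i: "i \<in> {1..n}" "w = shift i 1 w'" "sum w' {1..n} = Suc 0"
      by (rule sum_pos_obtain) auto
    from i(3) obtain j w'' where j: "j \<in> {1..n}" "w' = shift j 1 w''" "sum w'' {1..n} = 0"
      by (rule sum_pos_obtain) auto
    have "dcoeff n P u w = dcoeff n P u (yy i j)"
      using j(3) unfolding i(2) j(2) by (intro dcoeff_cong) (simp_all add: shift_def)
    with ne off[OF i(1) j(1)] diag[OF j(1)] show False by (cases "i = j") auto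
  qed
qed

section \<open>Subspace structure and the coefficient of y_1 y_2\<close>

lemma alt_harm_bi_0: "0 \<in> alt_harm_bi n k l"
  unfolding alt_harm_bi_iff using polys_0 by simp

lemma alt_harm_bi_add:
  assumes "P \<in> alt_harm_bi n k l" "Q \<in> alt_harm_bi n k l"
  shows "P + Q \<in> alt_harm_bi n k l"
  unfolding alt_harm_bi_iff
proof (intro conjI allI impI)
  note P = alt_harm_biD[OF assms(1)] and Q = alt_harm_biD[OF assms(2)]
  fix u w
  show "(\<Sum>i=1..n. dcoeff n (P + Q) (shift i a u) (shift i b w)) = 0" if "a + b > 0" for a b
    using P(2)[OF that] Q(2)[OF that] by (simp add: sum.distrib)
  show "dcoeff n (P + Q) (u \<circ> \<sigma>) (w \<circ> \<sigma>) = of_int (sign \<sigma>) * dcoeff n (P + Q) u w"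
    if "\<sigma> permutes {1..n}" for \<sigma>
    unfolding dcoeff_add P(3)[OF that] Q(3)[OF that] by (rule distrib_left[symmetric])
  assume "dcoeff n (P + Q) u w \<noteq> 0"
  hence "dcoeff n P u w \<noteq> 0 \<or> dcoeff n Q u w \<noteq> 0" by auto
  thus "int (sum u {1..n}) = int (\<Sum>i=1..n. n - i) - k" "int (sum w {1..n}) = l"
    using P(4,5) Q(4,5) by blast+
qed (intro polys_add alt_harm_biD(1)[OF assms(1)] alt_harm_biD(1)[OF assms(2)])

lemma alt_harm_bi_scal:
  assumes "P \<in> alt_harm_bi n k l"
  shows "scal c P \<in> alt_harm_bi n k l"
  unfolding alt_harm_bi_iff
proof (intro conjI allI impI)
  note P = alt_harm_biD[OF assms]
  fix u w
  show "(\<Sum>i=1..n. dcoeff n (scal c P) (shift i a u) (shift i b w)) = 0" if "a + b > 0" for a b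
    using P(2)[OF that] by (simp flip: sum_distrib_left)
  show "dcoeff n (scal c P) (u \<circ> \<sigma>) (w \<circ> \<sigma>) = of_int (sign \<sigma>) * dcoeff n (scal c P) u w"
    if "\<sigma> permutes {1..n}" for \<sigma>
    unfolding dcoeff_scal P(3)[OF that] by (rule mult.left_commute)
  assume "dcoeff n (scal c P) u w \<noteq> 0"
  hence "dcoeff n P u w \<noteq> 0" by auto
  thus "int (sum u {1..n}) = int (\<Sum>i=1..n. n - i) - k" "int (sum w {1..n}) = l"
    using P(4,5) by blast+
qed (intro polys_scal alt_harm_biD(1)[OF assms])

lemma subspace_alt_harm_bi: "qvs.subspace (alt_harm_bi n k l)"
  unfolding qvs.subspace_def using alt_harm_bi_0 alt_harm_bi_add alt_harm_bi_scal by blast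

lemma E_op_E_op_Delta_in_alt_harm_bi:
  assumes "a > 0" "b > 0"
  shows "E_op n a (E_op n b (Delta_poly n)) \<in> alt_harm_bi n (int (a + b)) 2"
  using E_op_in_alt_harm_bi[OF E_op_in_alt_harm_bi[OF Delta_poly_in_alt_harm_bi assms(2)] assms(1), of n]
  by (simp add: add.commute)

text \<open>Transpositions among the indices from 3 on, and the one of 1 and 2, fix y_1 y_2, so
  these alternations pass from P to its coefficient.\<close>

lemma dcoeff_y12:
  assumes n: "n \<ge> 2" and P: "P \<in> alt_harm_bi n k 2"
  defines "\<phi> \<equiv> \<lambda>u. dcoeff n P u (yy 1 2)"
  shows "if k < 0 then \<forall>u. \<phi> u = 0 else
    \<exists>c. (\<forall>a\<le>nat k. c (nat k - a) = c a) \<and>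
      (\<forall>u. \<phi> u = (\<Sum>a\<le>nat k. c a * vdm n (shift 1 a (shift 2 (nat k - a) u))))"
proof -
  interpret staircase n "vdm n" by (rule staircase_vdm)
  show ?thesis
  proof (rule alt_harm_homogeneous[OF n])
    show "harm_on {1..n} \<phi>"
      unfolding harm_on_def \<phi>_def
    proof (intro allI impI)
      fix r u assume "(r::nat) > 0"
      thus "(\<Sum>i=1..n. dcoeff n P (shift i r u) (yy 1 2)) = 0"
        using alt_harm_biD(2)[OF P, of r 0 u "yy 1 2"] by simp
    qed
    show "depends_on {1..n} \<phi>"
      unfolding depends_on_def \<phi>_def by (auto intro: dcoeff_cong)
    show "alt_on {3..n} \<phi>"
      unfolding alt_on_def
    proof (intro ballI impI allI)
      fix i j u assume ij: "i \<in> {3..n}" "j \<in> {3..n}" "i \<noteq> j"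
      hence t: "transpose i j 1 = 1" "transpose i j 2 = 2" by (auto intro!: transpose_apply_other)
      show "\<phi> (u \<circ> transpose i j) = - \<phi> u"
        using dcoeff_transpose[OF P, of i j u 1 2] ij unfolding \<phi>_def t by simp
    qed
    show "\<phi> (u \<circ> transpose 1 2) = - \<phi> u" for u
      using dcoeff_transpose[OF P, of 1 2 u 1 2] n unfolding \<phi>_def by (simp add: shift_commute[of 2])
    show "int (sum u {1..n}) = int (\<Sum>i=1..n. n - i) - k" if "\<phi> u \<noteq> 0" for u
      using alt_harm_biD(4)[OF P] that unfolding \<phi>_def by blast
  qed
qed

text \<open>For K \<ge> n - 1 the coinvariant relations suffice. For smaller K both exponents are at
  most n - 2 already, and only the ends a = 0 and a = K must go; by symmetry it is enough that c K =
  0.\<close>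

lemma dcoeff_y12_reduced:
  assumes n: "n \<ge> 2" and P: "P \<in> alt_harm_bi n (int K) 2"
  shows "\<exists>d. \<forall>u. dcoeff n P u (yy 1 2) =
    (\<Sum>a | 1 \<le> a \<and> a \<le> n - 2 \<and> a < K \<and> K - a \<le> n - 2. d a * vdm n (shift 1 a (shift 2 (K - a) u)))"
proof -
  interpret staircase n "vdm n" by (rule staircase_vdm)
  obtain c where sym: "\<And>a. a \<le> K \<Longrightarrow> c (K - a) = c a"
    and c: "\<And>u. dcoeff n P u (yy 1 2) = (\<Sum>a\<le>K. c a * DD a (K - a) u)"
    using dcoeff_y12[OF n P] by (simp split: if_splits) blast
  show ?thesis
  proof (cases "K \<ge> n - 1")
    case True
    from reduce_high[where K = K and c = c, OF n True sym] show ?thesis unfolding c .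
  next
    case False
    hence K: "K \<le> n - 2" by simp
    have ci: "dcoeff n P u (yy i 1) = (\<Sum>a\<le>K. c a * vdm n (shift 1 a (shift i (K - a) u)))"
      if i: "i \<in> {2..n}" for i u
    proof (cases "i = 2")
      case True
      thus ?thesis using c[of u] by (simp add: shift_commute[of 2 1 1])
    next
      case False
      let ?t = "transpose 2 i"
      have t: "?t 1 = 1" "?t 2 = i" using i by (auto intro!: transpose_apply_other)
      have "dcoeff n P u (yy i 1) = - dcoeff n P (u \<circ> ?t) (yy 1 2)"
        using dcoeff_transpose[OF P, of 2 i u 1 2] i False unfolding t by (simp add: shift_commute[of i 1 1])
      also have "\<dots> = (\<Sum>a\<le>K. c a * - DD a (K - a) (u \<circ> ?t))"
        unfolding c by (simp add: sum_negf)
      also have "\<dots> = (\<Sum>a\<le>K. c a * vdm n (shift 1 a (shift i (K - a) u)))"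
      proof (intro sum.cong refl arg_cong2[of _ _ _ _ "(*)"])
        fix a
        show "- DD a (K - a) (u \<circ> ?t) = vdm n (shift 1 a (shift i (K - a) u))"
          unfolding shift_comp_transpose t
          using alt_onD[OF D_alt, of 2 i "shift 1 a (shift i (K - a) u)"] i False by simp
      qed
      finally show ?thesis .
    qed
    \<comment> \<open>The coefficient of y_1 in \<Sum> \<partial>x_i^r \<partial>y_i P = 0. The
      index 1 contributes the unknown coefficient of y_1^2, which is eliminated between r = 0 and r
      = 1.\<close>
    have sum: "dcoeff n P (shift 1 r u) (yy 1 1) +
        (\<Sum>i=2..n. \<Sum>a\<le>K. c a * vdm n (shift 1 a (shift i (K - a) (shift i r u)))) = 0" for r u
    proof -
      have ins: "{1..n} = insert 1 {2..n}" using n by auto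
      have "0 = (\<Sum>i=1..n. dcoeff n P (shift i r u) (yy i 1))"
        using alt_harm_biD(2)[OF P, of r 1 u "shift 1 1 (\<lambda>_. 0)"] by simp
      also have "\<dots> = dcoeff n P (shift 1 r u) (yy 1 1) + (\<Sum>i=2..n. dcoeff n P (shift i r u) (yy i 1))"
        unfolding ins by simp
      also have "(\<Sum>i=2..n. dcoeff n P (shift i r u) (yy i 1)) =
          (\<Sum>i=2..n. \<Sum>a\<le>K. c a * vdm n (shift 1 a (shift i (K - a) (shift i r u))))"
        by (intro sum.cong refl ci)
      finally show ?thesis by simp
    qed
    have "c K = 0"
    proof (rule end_coeff_eq_0[where c = c and \<psi> = "\<lambda>u. dcoeff n P u (yy 1 1)", OF n K])
      show "dcoeff n P u (yy 1 1) + (\<Sum>i=2..n. \<Sum>a\<le>K. c a * vdm n (shift 1 a (shift i (K - a) u))) = 0" for u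
        using sum[of 0 u] by (simp only: shift_0)
    qed (rule sum)
    hence c0: "c a = 0" if "a = 0 \<or> a = K" for a using that sym[of 0] by auto
    have "(\<Sum>a\<le>K. c a * DD a (K - a) u) =
        (\<Sum>a | 1 \<le> a \<and> a \<le> n - 2 \<and> a < K \<and> K - a \<le> n - 2. c a * DD a (K - a) u)" for u
    proof (rule sum.mono_neutral_right)
      show "\<forall>a\<in>{..K} - {a. 1 \<le> a \<and> a \<le> n - 2 \<and> a < K \<and> K - a \<le> n - 2}. c a * DD a (K - a) u = 0"
      proof
        fix a assume "a \<in> {..K} - {a. 1 \<le> a \<and> a \<le> n - 2 \<and> a < K \<and> K - a \<le> n - 2}"
        hence "a = 0 \<or> a = K" using K by auto
        thus "c a * DD a (K - a) u = 0" using c0 by simp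
      qed
    qed auto
    thus ?thesis unfolding c by blast
  qed
qed

section \<open>Spanning sets and the tableau polynomials\<close>

abbreviation EE :: "nat \<Rightarrow> nat \<Rightarrow> nat \<Rightarrow> qpoly" where
  "EE n K i \<equiv> E_op n (K - i) (E_op n i (Delta_poly n))"

text \<open>As the operators commute, one index per unordered pair of exponents suffices:
  \<open>i\<close> is the smaller and \<open>K - i\<close> the larger.\<close>

definition EE_idx :: "nat \<Rightarrow> nat \<Rightarrow> nat set" where
  "EE_idx n K = {i. 1 \<le> i \<and> 2 * i \<le> K \<and> K - i \<le> n - 2}"

lemma finite_EE_idx: "finite (EE_idx n K)"
  by (rule finite_subset[of _ "{..K}"]) (auto simp: EE_idx_def)

lemma span_EE:
  assumes n: "n \<ge> 2"
  shows "qvs.span (EE n K ` EE_idx n K) = alt_harm_bi n (int K) 2"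
proof (rule antisym)
  have "EE n K i \<in> alt_harm_bi n (int K) 2" if "i \<in> EE_idx n K" for i
    using E_op_E_op_Delta_in_alt_harm_bi[of "K - i" i n] that unfolding EE_idx_def by simp
  thus "qvs.span (EE n K ` EE_idx n K) \<subseteq> alt_harm_bi n (int K) 2"
    by (intro qvs.span_minimal subspace_alt_harm_bi) auto
next
  interpret staircase n "vdm n" by (rule staircase_vdm)
  let ?S = "{a. 1 \<le> a \<and> a \<le> n - 2 \<and> a < K \<and> K - a \<le> n - 2}"
  let ?EE = "\<lambda>a. E_op n a (E_op n (K - a) (Delta_poly n))"
  show "alt_harm_bi n (int K) 2 \<subseteq> qvs.span (EE n K ` EE_idx n K)"
  proof
    fix P assume P: "P \<in> alt_harm_bi n (int K) 2"
    obtain d where d: "\<And>u. dcoeff n P u (yy 1 2) = (\<Sum>a\<in>?S. d a * DD a (K - a) u)"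
      using dcoeff_y12_reduced[OF n P] by blast
    \<comment> \<open>The coefficient of y_1 y_2 in \<open>?EE a\<close> contains both orders of the
      exponents. Alternation makes the two resulting sums equal, hence the factor 1/2.\<close>
    define Q where "Q = (\<Sum>a\<in>?S. scal (d a / 2) (?EE a))"
    have Q_in: "Q \<in> alt_harm_bi n (int K) 2"
      unfolding Q_def
    proof (intro qvs.subspace_sum[OF subspace_alt_harm_bi] alt_harm_bi_scal)
      fix a assume "a \<in> ?S"
      thus "?EE a \<in> alt_harm_bi n (int K) 2" using E_op_E_op_Delta_in_alt_harm_bi[of a "K - a" n] by simp
    qed
    have "dcoeff n Q u (yy 1 2) = dcoeff n P u (yy 1 2)" for u
    proof -
      have "(\<Sum>a\<in>?S. d a * DD (K - a) a u) = - (\<Sum>a\<in>?S. d a * DD a (K - a) (u \<circ> transpose 1 2))"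
        unfolding DD_swap[OF n] by (simp add: sum_negf)
      also have "\<dots> = - dcoeff n P (u \<circ> transpose 1 2) (yy 1 2)" unfolding d ..
      also have "\<dots> = dcoeff n P u (yy 1 2)"
        using dcoeff_transpose[OF P, of 1 2 u 1 2] n by (simp add: shift_commute[of 2])
      finally have swap: "(\<Sum>a\<in>?S. d a * DD (K - a) a u) = dcoeff n P u (yy 1 2)" .
      have "dcoeff n Q u (yy 1 2) = (\<Sum>a\<in>?S. d a / 2 * (DD a (K - a) u + DD (K - a) a u))"
        unfolding Q_def using n by (simp add: dcoeff_E_op_E_op_Delta shift_commute[of 2])
      also have "\<dots> = ((\<Sum>a\<in>?S. d a * DD a (K - a) u) + (\<Sum>a\<in>?S. d a * DD (K - a) a u)) / 2"
        by (simp add: sum.distrib[symmetric] sum_divide_distrib distrib_left add_divide_distrib)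
      also have "\<dots> = dcoeff n P u (yy 1 2)" unfolding swap d[symmetric] by simp
      finally show ?thesis .
    qed
    hence "P - Q = 0"
      using P Q_in by (intro alt_harm_bi_2_eq_0[OF n] qvs.subspace_diff[OF subspace_alt_harm_bi]) simp_all
    moreover have "Q \<in> qvs.span (EE n K ` EE_idx n K)"
      unfolding Q_def
    proof (intro qvs.span_sum qvs.span_scale qvs.span_base)
      fix a assume a: "a \<in> ?S"
      show "?EE a \<in> EE n K ` EE_idx n K"
      proof (cases "2 * a \<le> K")
        case True
        have "?EE a = EE n K a" by (rule E_op_commute[OF polys_Delta_poly])
        thus ?thesis using a True by (auto simp: EE_idx_def)
      next
        case False
        have "?EE a = EE n K (K - a)" using a by simp
        thus ?thesis using a False by (intro image_eqI[of _ _ "K - a"]) (auto simp: EE_idx_def)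
      qed
    qed
    ultimately show "P \<in> qvs.span (EE n K ` EE_idx n K)" by simp
  qed
qed

text \<open>The condition says K - i \<ge> i + 2, the column tableaux. Otherwise K - i is i or i +
  1, a row tableau; this is the largest index, with no successor to subtract.\<close>

definition tab_basis :: "nat \<Rightarrow> nat \<Rightarrow> nat \<Rightarrow> qpoly" where
  "tab_basis n K i = (if 2 * (i + 1) \<le> K then EE n K i - EE n K (i + 1) else EE n K i)"

lemma tableau_polys_eq: "tableau_polys n (int K) = tab_basis n K ` EE_idx n K"
proof (rule antisym)
  show "tableau_polys n (int K) \<subseteq> tab_basis n K ` EE_idx n K"
  proof
    fix P assume "P \<in> tableau_polys n (int K)"
    then consider (1) i where "P = E_op n i (E_op n i (Delta_poly n))" "1 \<le> i" "int i \<le> int n - 2" "2 * int i = int K"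
      | (2) i where "P = E_op n i (E_op n (i + 1) (Delta_poly n))" "1 \<le> i" "int i \<le> int n - 3" "2 * int i + 1 = int K"
      | (3) i j where "P = E_op n j (E_op n i (Delta_poly n)) - E_op n (j - 1) (E_op n (i + 1) (Delta_poly n))"
        "1 \<le> i" "int i \<le> int n - 4" "i + 2 \<le> j" "int j \<le> int n - 2" "int i + int j = int K"
      unfolding tableau_polys_def by blast
    thus "P \<in> tab_basis n K ` EE_idx n K"
    proof cases
      case 1
      hence "K - i = i" by linarith
      thus ?thesis using 1 by (intro image_eqI[of _ _ i]) (auto simp: tab_basis_def EE_idx_def)
    next
      case 2
      hence "K - i = i + 1" by linarith
      moreover have "P = E_op n (i + 1) (E_op n i (Delta_poly n))"
        unfolding 2(1) by (rule E_op_commute[OF polys_Delta_poly])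
      ultimately show ?thesis using 2 by (intro image_eqI[of _ _ i]) (auto simp: tab_basis_def EE_idx_def)
    next
      case 3
      hence "K - i = j" "K - (i + 1) = j - 1" by linarith+
      thus ?thesis using 3 by (intro image_eqI[of _ _ i]) (auto simp: tab_basis_def EE_idx_def)
    qed
  qed
next
  show "tab_basis n K ` EE_idx n K \<subseteq> tableau_polys n (int K)"
  proof clarify
    fix i assume i: "i \<in> EE_idx n K"
    consider "2 * (i + 1) \<le> K" | "K = 2 * i + 1" | "K = 2 * i"
      using i unfolding EE_idx_def by fastforce
    thus "tab_basis n K i \<in> tableau_polys n (int K)"
    proof cases
      case 1
      have "tab_basis n K i = E_op n (K - i) (E_op n i (Delta_poly n)) - E_op n (K - i - 1) (E_op n (i + 1) (Delta_poly n))"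
        using 1 by (simp add: tab_basis_def)
      moreover have "1 \<le> i \<and> int i \<le> int n - 4 \<and> i + 2 \<le> K - i \<and> int (K - i) \<le> int n - 2 \<and> int i + int (K - i) = int K"
        using i 1 unfolding EE_idx_def by auto
      ultimately show ?thesis unfolding tableau_polys_def by blast
    next
      case 2
      have "tab_basis n K i = E_op n (i + 1) (E_op n i (Delta_poly n))"
        using 2 by (simp add: tab_basis_def)
      also have "\<dots> = E_op n i (E_op n (i + 1) (Delta_poly n))"
        by (rule E_op_commute[OF polys_Delta_poly])
      finally have "tab_basis n K i = E_op n i (E_op n (i + 1) (Delta_poly n))" .
      moreover have "1 \<le> i \<and> int i \<le> int n - 3 \<and> 2 * int i + 1 = int K"
        using i 2 unfolding EE_idx_def by auto
      ultimately show ?thesis unfolding tableau_polys_def by blast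
    next
      case 3
      have "tab_basis n K i = E_op n i (E_op n i (Delta_poly n))"
        using 3 by (simp add: tab_basis_def)
      moreover have "1 \<le> i \<and> int i \<le> int n - 2 \<and> 2 * int i = int K"
        using i 3 unfolding EE_idx_def by auto
      ultimately show ?thesis unfolding tableau_polys_def by blast
    qed
  qed
qed

lemma EE_idx_Suc: "i \<in> EE_idx n K \<Longrightarrow> 2 * (i + 1) \<le> K \<Longrightarrow> i + 1 \<in> EE_idx n K"
  unfolding EE_idx_def by auto

text \<open>Summing \<open>tab_basis\<close> from i up to the largest index telescopes to
  \<open>EE n K i\<close>; hence the induction on K - i, downwards in i.\<close>

lemma span_tab_basis: "qvs.span (tab_basis n K ` EE_idx n K) = qvs.span (EE n K ` EE_idx n K)"
proof (rule antisym)
  have "tab_basis n K i \<in> qvs.span (EE n K ` EE_idx n K)" if "i \<in> EE_idx n K" for i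
    using that EE_idx_Suc[OF that] unfolding tab_basis_def
    by (auto intro: qvs.span_diff qvs.span_base)
  thus "qvs.span (tab_basis n K ` EE_idx n K) \<subseteq> qvs.span (EE n K ` EE_idx n K)"
    by (intro qvs.span_minimal qvs.subspace_span) auto
next
  have "EE n K i \<in> qvs.span (tab_basis n K ` EE_idx n K)" if "i \<in> EE_idx n K" for i
    using that
  proof (induction "K - i" arbitrary: i rule: less_induct)
    case less
    have B: "tab_basis n K i \<in> qvs.span (tab_basis n K ` EE_idx n K)"
      using less.prems by (intro qvs.span_base) auto
    show ?case
    proof (cases "2 * (i + 1) \<le> K")
      case True
      have "EE n K (i + 1) \<in> qvs.span (tab_basis n K ` EE_idx n K)"
        using True EE_idx_Suc[OF less.prems True] by (intro less.hyps) auto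
      moreover have "EE n K i = tab_basis n K i + EE n K (i + 1)" using True by (simp add: tab_basis_def)
      ultimately show ?thesis using B qvs.span_add by metis
    next
      case False
      thus ?thesis using B by (simp add: tab_basis_def)
    qed
  qed
  thus "qvs.span (EE n K ` EE_idx n K) \<subseteq> qvs.span (tab_basis n K ` EE_idx n K)"
    by (intro qvs.span_minimal qvs.subspace_span) auto
qed

section \<open>Linear independence\<close>

lemma independent_triangular:
  fixes B :: "nat \<Rightarrow> qpoly"
  assumes fin: "finite I"
    and upper: "\<And>i j. i \<in> I \<Longrightarrow> j \<in> I \<Longrightarrow> i < j \<Longrightarrow> dcoeff n (B j) (m i) w = 0"
    and diag: "\<And>i. i \<in> I \<Longrightarrow> dcoeff n (B i) (m i) w \<noteq> 0"
  shows "qvs.independent (B ` I)"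
proof -
  \<comment> \<open>Independence concerns the image as a set, so the members must first be shown
    distinct; triangularity gives this as well.\<close>
  have inj: "inj_on B I"
  proof (rule linorder_inj_onI)
    fix i j assume "i < j" "i \<in> I" "j \<in> I"
    thus "B i \<noteq> B j" using upper[of i j] diag[of i] by auto
  qed auto
  show ?thesis
  proof (rule qvs.independent_if_scalars_zero)
    fix f x assume s: "(\<Sum>x\<in>B ` I. scal (f x) x) = 0" and x: "x \<in> B ` I"
    have s': "(\<Sum>i\<in>I. scal (f (B i)) (B i)) = 0" using s by (simp add: sum.reindex[OF inj])
    have "f (B i) = 0" if "i \<in> I" for i
      using that
    proof (induction i rule: less_induct)
      case (less i)
      have "(\<Sum>j\<in>I. f (B j) * dcoeff n (B j) (m i) w) = 0"
        using arg_cong[OF s', of "\<lambda>P. dcoeff n P (m i) w"] by simp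
      also have "(\<Sum>j\<in>I. f (B j) * dcoeff n (B j) (m i) w) =
          (\<Sum>j\<in>I. if j = i then f (B i) * dcoeff n (B i) (m i) w else 0)"
      proof (intro sum.cong refl)
        fix j assume "j \<in> I"
        thus "f (B j) * dcoeff n (B j) (m i) w = (if j = i then f (B i) * dcoeff n (B i) (m i) w else 0)"
          using less upper[of i j] by (cases i j rule: linorder_cases) auto
      qed
      finally show ?case using fin less.prems diag by simp
    qed
    thus "f x = 0" using x by blast
  qed (use fin in simp)
qed

lemma independent_tab_basis:
  assumes n: "n \<ge> 2"
  shows "qvs.independent (tab_basis n K ` EE_idx n K)"
proof -
  interpret staircase n "vdm n" by (rule staircase_vdm)
  \<comment> \<open>The staircase lowered by i in x_1 and by K - i in x_2, so that \<partial>_1^i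
    \<partial>_2^(K-i) leads to its coefficient 1. Every higher power of \<partial>_1 pushes the
    exponent of x_1 to n or beyond.\<close>
  define m where "m i = (\<lambda>l. n - l)(1 := n - 1 - i, 2 := n - 2 - (K - i))" for i
  have stair: "DD i (K - i) (m i) = 1" if "i \<in> EE_idx n K" for i
  proof -
    have "shift 1 i (shift 2 (K - i) (m i)) = (\<lambda>l. n - l)"
      using that unfolding m_def EE_idx_def by (auto simp: shift_def fun_eq_iff)
    thus ?thesis using D_stair by simp
  qed
  have big: "DD j b (m i) = 0" if "i \<in> EE_idx n K" "i < j" for i j b
    using that n unfolding EE_idx_def by (intro D_eq_0[of 1]) (auto simp: shift_def m_def)
  have EE: "dcoeff n (EE n K j) (m i) (yy 1 2) = DD (K - j) j (m i) + DD j (K - j) (m i)" for i j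
    using n by (simp add: dcoeff_E_op_E_op_Delta shift_commute[of 2])
  \<comment> \<open>Since i < j \<le> K - j, both exponents j and K - j exceed i, and both terms
    vanish.\<close>
  have upper: "dcoeff n (EE n K j) (m i) (yy 1 2) = 0" if "i \<in> EE_idx n K" "j \<in> EE_idx n K" "i < j" for i j
    using big[of i j] big[of i "K - j"] that unfolding EE by (auto simp: EE_idx_def)
  show ?thesis
  proof (rule independent_triangular[OF finite_EE_idx, where m = m and w = "yy 1 2"])
    fix i j assume ij: "i \<in> EE_idx n K" "j \<in> EE_idx n K" "i < j"
    thus "dcoeff n (tab_basis n K j) (m i) (yy 1 2) = 0"
      using upper[OF ij] upper[OF ij(1) EE_idx_Suc[OF ij(2)]] unfolding tab_basis_def by auto
  next
    fix i assume i: "i \<in> EE_idx n K"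
    \<comment> \<open>The two terms coincide if K - i = i, giving the value 2; otherwise K - i > i
      makes one vanish and the value is 1.\<close>
    have "DD (K - i) i (m i) = 0 \<or> DD (K - i) i (m i) = 1"
    proof (cases "K - i = i")
      case True
      thus ?thesis using stair[OF i] by simp
    next
      case False
      thus ?thesis using big[OF i, of "K - i"] i by (auto simp: EE_idx_def)
    qed
    hence "dcoeff n (EE n K i) (m i) (yy 1 2) \<noteq> 0" unfolding EE stair[OF i] by auto
    thus "dcoeff n (tab_basis n K i) (m i) (yy 1 2) \<noteq> 0"
      using upper[OF i EE_idx_Suc[OF i]] unfolding tab_basis_def by auto
  qed
qed

theorem mainTheorem5:
  fixes n :: nat and k :: int
  assumes "n \<ge> 2"
  shows "(2 \<le> k \<and> k \<le> 2 * int n - 2 \<longrightarrow> is_basis_of (tableau_polys n k) (alt_harm_bi n k 2)) \<and>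
         (\<not> (2 \<le> k \<and> k \<le> 2 * int n - 2) \<longrightarrow> qvs.dim (alt_harm_bi n k 2) = 0)"
proof (intro conjI impI)
  assume "2 \<le> k \<and> k \<le> 2 * int n - 2"
  \<comment> \<open>For k = 2 n - 3 and k = 2 n - 2 the index set is empty, and the empty basis
    expresses that the space is zero.\<close>
  then obtain K where k: "k = int K" by (metis nonneg_int_cases order_trans zero_le_numeral)
  show "is_basis_of (tableau_polys n k) (alt_harm_bi n k 2)"
    unfolding is_basis_of_def k tableau_polys_eq span_tab_basis span_EE[OF assms]
    using independent_tab_basis[OF assms] by blast
next
  assume k: "\<not> (2 \<le> k \<and> k \<le> 2 * int n - 2)"
  have "alt_harm_bi n k 2 = qvs.span {}"
  proof (cases "k < 0")
    case True
    have "P = 0" if "P \<in> alt_harm_bi n k 2" for P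
      using dcoeff_y12[OF assms that] True by (intro alt_harm_bi_2_eq_0[OF assms that]) simp
    thus ?thesis using alt_harm_bi_0 by auto
  next
    case False
    then obtain K where K: "k = int K" by (metis nonneg_int_cases not_less)
    \<comment> \<open>An index i would give 2 \<le> 2 i \<le> K and, from i \<le> K - i \<le> n - 2,
      also K \<le> 2 n - 4.\<close>
    have "EE_idx n K = {}" using k assms unfolding EE_idx_def K by auto
    thus ?thesis using span_EE[OF assms, of K] unfolding K by simp
  qed
  thus "qvs.dim (alt_harm_bi n k 2) = 0"
    using qvs.dim_span_eq_card_independent[OF qvs.independent_empty] by (simp only: card.empty)
qed

end
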